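(* Let $d\ge 2$ and let $G_4^E$ be the Euclidean four-point function of identical scalar primary operators of scaling dimension $\Delta$ in a unitary CFT (i.e. $G_4^E$ satisfies the standing properties listed in the context). Then there exists a function $G_4(x_1,x_2,x_3,x_4)$ on $$\mathcal{D}=\{(\tau_k,\mathbf{x}_k)_{k=1}^4:\ \tau_k\in\mathbb{C},\ \mathbf{x}_k\in\mathbb{R}^{d-1},\ \mathrm{Re}\,\tau_1>\mathrm{Re}\,\tau_2>\mathrm{Re}\,\tau_3>\mathrm{Re}\,\tau_4\}$$ which is analytic in the temporal variables $\tau_k$, continuous in the spatial variables $\mathbf{x}_k$, and agrees with $G_4^E$ when all $\tau_k$ are real.
   Context: Kinematics. Points are $x_k=(\tau_k,\mathbf{x}_k)$; $x_{ij}^2=(\tau_i-\tau_j)^2+(\mathbf{x}_i-\mathbf{x}_j)^2$ (a complex number if $\tau$'s are complex; nonzero for $i\ne j$ on $\mathcal{D}$). Cross-ratios: $u=\frac{x_{12}^2x_{34}^2}{x_{13}^2x_{24}^2}$, $v=\frac{x_{14}^2x_{23}^2}{x_{13}^2x_{24}^2}$. The numbers $z,\bar z$ are the two solutions (unordered) of $u=z\bar z$, $v=(1-z)(1-\bar z)$. The map $\rho(z)=\frac{(1-\sqrt{1-z})^2}{z}$ is a holomorphic bijection from $\mathbb{C}\setminus[1,\infty)$ to the open unit disc, and $\rho=\rho(z)$, $\bar\rho=\rho(\bar z)$. Known fact (to be used as given): for every configuration in $\mathcal{D}$ one has $z,\bar z\notin[1,\infty)$, i.e. $|\rho|,|\bar\rho|<1$.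 Standing properties of the Euclidean four-point function. $G_4^E$ is a function of four pairwise distinct points of $\mathbb{R}^d$, invariant under permutations of the points, of the form $G_4^E=\frac{g(u,v)}{(x_{12}^2)^{\Delta}(x_{34}^2)^{\Delta}}$. For Euclidean configurations with $z\notin[1,\infty)$ (there $\bar z=z^*$, $\bar\rho=\rho^*$), $g$ has the expansion $$g=\sum_{\delta\ge0}\sum_{l\in\mathbb{N}}c_{\delta,l}(\rho\bar\rho)^{\delta/2}P^l(\rho,\bar\rho),\qquad P^l(\rho,\bar\rho)=\sum_{k=0}^l p^l_k\Big(\frac{\rho}{\bar\rho}\Big)^{l/2-k},\quad p^l_k=p^l_{l-k},$$ where $c_{\delta,l}\ge 0$ (countably many nonzero), and $P^l=C_l^{d/2-1}(\cos\theta)$ is a Gegenbauer polynomial for $\rho=re^{i\theta}$, $\bar\rho=re^{-i\theta}$ (suitably normalized, $\propto\cos l\theta$, for $d=2$). Expanding, $g=\sum_{h,\bar h\ge0}b_{h,\bar h}\rho^h\bar\rho^{\bar h}$ with $b_{h,\bar h}\ge 0$, $h-\bar h\in\mathbb{Z}$, and this series converges absolutely whenever $0<|\rho|,|\bar\rho|<1$. *)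

theory Defs
  imports "HOL-Analysis.Analysis"
begin

text \<open>
  A point is a pair \<open>(\<tau>, x)\<close> of a temporal and a spatial coordinate, with \<open>x\<close> in
  \<open>real ^ 'n\<close> and \<open>CARD('n) = d - 1\<close>. A configuration of four points is a vector indexed
  by the four-element type \<open>4\<close>, whose elements are \<open>1, 2, 3, 4\<close> (with \<open>4 = 0\<close>).
\<close>

type_synonym 'n econfig = "(real \<times> (real ^ 'n)) ^ 4"
type_synonym 'n cconfig = "(complex \<times> (real ^ 'n)) ^ 4"

definition complexify :: "'n econfig \<Rightarrow> 'n::finite cconfig" where
  "complexify X = (\<chi> k. (complex_of_real (fst (X $ k)), snd (X $ k)))"

definition config :: "complex ^ 4 \<Rightarrow> (real ^ 'n) ^ 4 \<Rightarrow> 'n::finite cconfig" where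
  "config t x = (\<chi> k. (t $ k, x $ k))"

definition ordered_domain :: "'n::finite cconfig set" where
  "ordered_domain = {X. Re (fst (X $ 1)) > Re (fst (X $ 2)) \<and>
                        Re (fst (X $ 2)) > Re (fst (X $ 3)) \<and>
                        Re (fst (X $ 3)) > Re (fst (X $ 4))}"

definition xsq :: "'n::finite cconfig \<Rightarrow> 4 \<Rightarrow> 4 \<Rightarrow> complex" where
  "xsq X i j = (fst (X $ i) - fst (X $ j))\<^sup>2
             + complex_of_real ((norm (snd (X $ i) - snd (X $ j)))\<^sup>2)"

definition cross_u :: "'n::finite cconfig \<Rightarrow> complex" where
  "cross_u X = (xsq X 1 2 * xsq X 3 4) / (xsq X 1 3 * xsq X 2 4)"

definition cross_v :: "'n::finite cconfig \<Rightarrow> complex" where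
  "cross_v X = (xsq X 1 4 * xsq X 2 3) / (xsq X 1 3 * xsq X 2 4)"

definition is_z_zbar :: "'n::finite cconfig \<Rightarrow> complex \<Rightarrow> complex \<Rightarrow> bool" where
  "is_z_zbar X z zb \<longleftrightarrow> cross_u X = z * zb \<and> cross_v X = (1 - z) * (1 - zb)"

definition rho :: "complex \<Rightarrow> complex" where
  "rho z = (1 - csqrt (1 - z))\<^sup>2 / z"

definition branch_cut :: "complex set" where
  "branch_cut = complex_of_real ` {1..}"

definition gegenbauer :: "nat \<Rightarrow> real \<Rightarrow> real \<Rightarrow> real" where
  "gegenbauer l a x = (\<Sum>j\<le>l div 2. (-1) ^ j * pochhammer a (l - j)
                        / (fact j * fact (l - 2 * j)) * (2 * x) ^ (l - 2 * j))"

text \<open>The polynomials \<open>gegenbauer l 0\<close> vanish for \<open>l > 0\<close>, so \<open>d = 2\<close> is a separate case.\<close>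

definition angular :: "nat \<Rightarrow> nat \<Rightarrow> real \<Rightarrow> real" where
  "angular d l \<theta> = (if d = 2 then cos (real l * \<theta>)
                    else gegenbauer l (real d / 2 - 1) (cos \<theta>))"

text \<open>
  The next two functions are only used when \<open>rb = cnj r\<close>, so that \<open>r * rb\<close> is a positive
  real and its principal powers are the positive ones. For \<open>r = R exp (i \<theta>)\<close> the power
  \<open>(r / rb) ^ (l / 2 - k)\<close> means \<open>exp (i (l - 2 k) \<theta>)\<close>. For odd \<open>l\<close> this is not the principal
  power of \<open>r / rb\<close>, and it is therefore written as \<open>r ^ (l - k) * rb ^ k / (r * rb) ^ (l / 2)\<close>.
  In the same way, \<open>r ^ h * rb ^ hb\<close> with integral \<open>h - hb\<close> is written as
  \<open>(r * rb) ^ hb * r ^ (h - hb)\<close>.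
\<close>

definition Ppoly :: "(nat \<Rightarrow> nat \<Rightarrow> real) \<Rightarrow> nat \<Rightarrow> complex \<Rightarrow> complex \<Rightarrow> complex" where
  "Ppoly p l r rb = (\<Sum>k\<le>l. complex_of_real (p l k) *
                      (r ^ (l - k) * rb ^ k / (r * rb) powr complex_of_real (real l / 2)))"

definition rho_monom :: "real \<Rightarrow> real \<Rightarrow> complex \<Rightarrow> complex \<Rightarrow> complex" where
  "rho_monom h hb r rb = (r * rb) powr complex_of_real hb * r powi \<lfloor>h - hb\<rfloor>"

text \<open>
  The coefficient of \<open>r ^ h * rb ^ hb\<close> in the sum of \<open>c \<delta> l * (r * rb) ^ (\<delta> / 2) * Ppoly p l r rb\<close>:
  the \<open>k\<close>-th term of \<open>Ppoly\<close> contributes to \<open>h = (\<delta> + l) / 2 - k\<close> and \<open>hb = (\<delta> - l) / 2 + k\<close>,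
  that is, \<open>\<delta> = h + hb\<close> and \<open>l - 2 * k = h - hb\<close>.
\<close>

definition bcoeff :: "(real \<Rightarrow> nat \<Rightarrow> real) \<Rightarrow> (nat \<Rightarrow> nat \<Rightarrow> real) \<Rightarrow> real \<Rightarrow> real \<Rightarrow> real" where
  "bcoeff c p h hb = (\<Sum>\<^sub>\<infinity>(l, k)\<in>{(l, k). k \<le> l \<and> real l - 2 * real k = h - hb}.
                        c (h + hb) l * p l k)"

definition weights :: "(real \<times> real) set" where
  "weights = {(h, hb). 0 \<le> h \<and> 0 \<le> hb \<and> h - hb \<in> \<int>}"

text \<open>
  The factors \<open>nrm l > 0\<close> account for the freedom in the normalization of the angular
  functions. In \<open>form\<close> the bases \<open>xsq\<close> are positive reals.
\<close>

locale euclidean_four_point =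
  fixes d :: nat
    and \<Delta> :: real
    and GE :: "'n::finite econfig \<Rightarrow> complex"
    and g :: "complex \<Rightarrow> complex \<Rightarrow> complex"
    and c :: "real \<Rightarrow> nat \<Rightarrow> real"
    and p :: "nat \<Rightarrow> nat \<Rightarrow> real"
    and nrm :: "nat \<Rightarrow> real"
  assumes permutation_invariant:
      "\<And>(X :: 'n econfig) \<pi>. inj (($) X) \<Longrightarrow> bij \<pi> \<Longrightarrow> GE (\<chi> k. X $ \<pi> k) = GE X"
    and form:
      "\<And>X :: 'n econfig. inj (($) X) \<Longrightarrow>
         GE X = g (cross_u (complexify X)) (cross_v (complexify X))
                / (xsq (complexify X) 1 2 powr complex_of_real \<Delta> *
                   xsq (complexify X) 3 4 powr complex_of_real \<Delta>)"
    and p_sym: "\<And>l k. k \<le> l \<Longrightarrow> p l k = p l (l - k)"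
    and nrm_pos: "\<And>l. nrm l > 0"
    and P_angular:
      "\<And>l r \<theta>. 0 < r \<Longrightarrow>
         Ppoly p l (complex_of_real r * cis \<theta>) (complex_of_real r * cis (- \<theta>))
           = complex_of_real (nrm l * angular d l \<theta>)"
    and c_nonneg: "\<And>\<delta> l. 0 \<le> \<delta> \<Longrightarrow> 0 \<le> c \<delta> l"
    and c_countable: "countable {(\<delta>, l). 0 \<le> \<delta> \<and> c \<delta> l \<noteq> 0}"
    and expansion_c:
      "\<And>(X :: 'n econfig) z zb. inj (($) X) \<Longrightarrow> is_z_zbar (complexify X) z zb \<Longrightarrow> z \<notin> branch_cut \<Longrightarrow>
         ((\<lambda>(\<delta>, l). complex_of_real (c \<delta> l) *
              (rho z * rho zb) powr complex_of_real (\<delta> / 2) * Ppoly p l (rho z) (rho zb))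
            has_sum g (cross_u (complexify X)) (cross_v (complexify X))) ({0..} \<times> UNIV)"
    and b_nonneg: "\<And>h hb. (h, hb) \<in> weights \<Longrightarrow> 0 \<le> bcoeff c p h hb"
    and expansion_b:
      "\<And>(X :: 'n econfig) z zb. inj (($) X) \<Longrightarrow> is_z_zbar (complexify X) z zb \<Longrightarrow> z \<notin> branch_cut \<Longrightarrow>
         ((\<lambda>(h, hb). complex_of_real (bcoeff c p h hb) * rho_monom h hb (rho z) (rho zb))
            has_sum g (cross_u (complexify X)) (cross_v (complexify X))) weights"
    and absolutely_convergent:
      "\<And>(r :: complex) (rb :: complex). 0 < norm r \<Longrightarrow> norm r < 1 \<Longrightarrow> 0 < norm rb \<Longrightarrow> norm rb < 1 \<Longrightarrow>
         (\<lambda>(h, hb). bcoeff c p h hb * norm r powr h * norm rb powr hb) summable_on weights"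

text \<open>
  Analyticity in several complex variables, by analogy with the definition of \<open>analytic_on\<close>
  for one variable: near every point of \<open>S\<close> there is a complex-linear Frechet derivative.
\<close>

definition analytic_several_on :: "(complex ^ 'm::finite \<Rightarrow> complex) \<Rightarrow> (complex ^ 'm) set \<Rightarrow> bool" where
  "analytic_several_on f S \<longleftrightarrow>
     (\<forall>t\<in>S. \<exists>e>0. \<forall>w\<in>ball t e. \<exists>a :: complex ^ 'm.
        (f has_derivative (\<lambda>y. \<Sum>k\<in>UNIV. a $ k * y $ k)) (at w))"

end

theory Submission
  imports Defs "HOL-Complex_Analysis.Cauchy_Integral_Formula"
begin

text \<open>
  Write \<open>\<rho> = (1 - a) / (1 + a)\<close> and \<open>\<rho>b = (1 - b) / (1 + b)\<close> with \<open>a = csqrt (1 - z)\<close> and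
  \<open>b = csqrt (1 - zb)\<close>. The individual roots are not analytic where \<open>z = zb\<close>, but
  \<open>a * b\<close> is a branch of the square root of \<open>v\<close> given by principal logarithms of the \<open>xsq\<close>,
  \<open>a + b\<close> is the principal root of \<open>1 - u + v + 2 * a * b\<close>, and from these one gets analytic
  formulas for \<open>\<rho> + \<rho>b\<close> and for a logarithm of \<open>\<rho> * \<rho>b\<close>. Since the coefficients are symmetric
  in \<open>h\<close> and \<open>hb\<close>, the expansion of \<open>g\<close> becomes a series of analytic functions, which
  converges locally uniformly because \<open>max \<bar>\<rho>\<bar> \<bar>\<rho>b\<bar>\<close> is continuous and below 1.

  That \<open>z\<close> avoids \<open>{1..}\<close> is a form of Stewart's theorem: after an inversion centred at
  the second point, \<open>z = 1 / l\<close> would make the first point null separated from the point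
  dividing the segment from the third to the fourth in the ratio \<open>l : 1 - l\<close>. The tube
  \<open>Re \<tau> > \<bar>Im x\<bar>\<close> is a convex cone preserved by the inversion, on which the square
  \<open>\<tau>\<^sup>2 + x\<^sup>2\<close> does not vanish.
\<close>

section \<open>Inversion and the tube\<close>

text \<open>The complex spatial vector is \<open>a + \<i> b\<close>.\<close>

lemma tube_square_nonzero:
  fixes t :: complex and a b :: "'a::real_inner"
  assumes "norm b < Re t"
  shows "t\<^sup>2 + of_real (a \<bullet> a - b \<bullet> b) + 2 * \<i> * of_real (a \<bullet> b) \<noteq> 0"
proof
  assume eq: "t\<^sup>2 + of_real (a \<bullet> a - b \<bullet> b) + 2 * \<i> * of_real (a \<bullet> b) = 0"
  have pos: "Re t > 0"
    using assms norm_ge_zero[of b] by linarith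
  from eq have re: "(Re t)\<^sup>2 - (Im t)\<^sup>2 + a \<bullet> a - b \<bullet> b = 0"
    and im: "2 * (Re t * Im t + a \<bullet> b) = 0"
    by (auto simp: complex_eq_iff power2_eq_square algebra_simps)
  \<comment> \<open>The imaginary part and Cauchy-Schwarz bound \<open>|Im t|\<close> by
    \<open>norm a\<close>. The real part is then at least \<open>(Re t)^2 - b \<bullet> b\<close>,
    which is positive.\<close>
  have "(Re t * Im t)\<^sup>2 = (a \<bullet> b)\<^sup>2"
  proof -
    have "Re t * Im t = - (a \<bullet> b)" using im unfolding mult_eq_0_iff by (auto simp only: eq_neg_iff_add_eq_0 zero_neq_numeral)
    thus ?thesis by (simp only: power2_minus)
  qed
  also have "\<dots> \<le> (a \<bullet> a) * (b \<bullet> b)"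
    by (rule Cauchy_Schwarz_ineq)
  also have "\<dots> \<le> (a \<bullet> a) * (Re t)\<^sup>2"
    using assms pos by (intro mult_left_mono) (auto simp: dot_square_norm intro!: power_mono)
  finally have "(Im t)\<^sup>2 \<le> a \<bullet> a"
    using pos by (simp add: power_mult_distrib mult.commute)
  moreover have "b \<bullet> b < (Re t)\<^sup>2"
    using assms by (simp add: dot_square_norm power_strict_mono)
  ultimately show False
    using re by linarith
qed

text \<open>This is the complex-bilinear square of
  \<open>\<alpha> x + \<beta> y + \<gamma> w\<close>, whose real and imaginary parts are
  \<open>a\<close> and \<open>b\<close>; the left side is the spatial part of the square in
  \<open>tube_square_nonzero\<close>.\<close>

lemma complex_combination_square:
  fixes \<alpha> \<beta> \<gamma> :: complex and x y w :: "'a::real_inner"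
  defines "a \<equiv> Re \<alpha> *\<^sub>R x + Re \<beta> *\<^sub>R y + Re \<gamma> *\<^sub>R w"
    and "b \<equiv> Im \<alpha> *\<^sub>R x + Im \<beta> *\<^sub>R y + Im \<gamma> *\<^sub>R w"
  shows "of_real (a \<bullet> a - b \<bullet> b) + 2 * \<i> * of_real (a \<bullet> b) =
    \<alpha>\<^sup>2 * of_real (x \<bullet> x) + \<beta>\<^sup>2 * of_real (y \<bullet> y) + \<gamma>\<^sup>2 * of_real (w \<bullet> w)
    + 2 * \<alpha> * \<beta> * of_real (x \<bullet> y) + 2 * \<alpha> * \<gamma> * of_real (x \<bullet> w) + 2 * \<beta> * \<gamma> * of_real (y \<bullet> w)"
  by (simp add: complex_eq_iff a_def b_def inner_simps power2_eq_square algebra_simps inner_commute)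

text \<open>The inverted point is \<open>(t / q, x / q)\<close>, with spatial imaginary part
  \<open>Im (1 / q) *\<^sub>R x\<close>, so the second claim places it in the tube. Multiplied by
  the squared modulus of \<open>q\<close> and divided by \<open>Re t\<close>, the claim becomes
  \<open>2 |Im t| |x| < (Re t)^2 + (Im t)^2 + |x|^2\<close>.\<close>

lemma inversion_tube:
  fixes t q :: complex and x :: "'a::real_inner"
  assumes "Re t > 0"
  defines "q \<equiv> t\<^sup>2 + of_real (x \<bullet> x)"
  shows "q \<notin> \<real>\<^sub>\<le>\<^sub>0" and "norm (Im (1 / q) *\<^sub>R x) < Re (t / q)"
proof -
  have q: "Re q = (Re t)\<^sup>2 - (Im t)\<^sup>2 + (norm x)\<^sup>2" "Im q = 2 * Re t * Im t"
    by (simp_all add: q_def power2_eq_square dot_square_norm)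
  show nonpos: "q \<notin> \<real>\<^sub>\<le>\<^sub>0"
  proof
    assume "q \<in> \<real>\<^sub>\<le>\<^sub>0"
    hence "Im t = 0" "Re q \<le> 0"
      using assms(1) q by (auto simp: complex_nonpos_Reals_iff)
    moreover have "(Re t)\<^sup>2 > 0"
      using assms(1) by simp
    ultimately show False
      using q zero_le_power2[of "norm x"] by (metis add_nonneg_pos add.commute diff_zero not_less power_zero_numeral)
  qed
  hence "q \<noteq> 0" by auto
  hence N: "(cmod q)\<^sup>2 > 0" by simp
  have "2 * \<bar>Im t\<bar> * norm x \<le> (Im t)\<^sup>2 + (norm x)\<^sup>2"
    using zero_le_power2[of "\<bar>Im t\<bar> - norm x"] by (simp add: power2_diff)
  also have "\<dots> < (Re t)\<^sup>2 + (Im t)\<^sup>2 + (norm x)\<^sup>2"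
    using assms(1) by simp
  finally have "Re t * (2 * \<bar>Im t\<bar> * norm x) < Re t * ((Re t)\<^sup>2 + (Im t)\<^sup>2 + (norm x)\<^sup>2)"
    using assms(1) by (rule mult_strict_left_mono)
  also have "\<dots> = Re t * Re q + Im t * Im q"
    by (simp add: q power2_eq_square algebra_simps)
  finally have "\<bar>Im q\<bar> * norm x < Re t * Re q + Im t * Im q"
    using assms(1) by (simp add: q abs_mult mult_ac)
  moreover have "norm (Im (1 / q) *\<^sub>R x) = \<bar>Im q\<bar> * norm x / (cmod q)\<^sup>2"
    by (simp add: Im_divide cmod_power2)
  moreover have "Re (t / q) = (Re t * Re q + Im t * Im q) / (cmod q)\<^sup>2"
    by (simp add: Re_divide cmod_power2)
  ultimately show "norm (Im (1 / q) *\<^sub>R x) < Re (t / q)"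
    using N by (simp add: divide_strict_right_mono)
qed

lemma of_real_mult_Im: "Im (of_real c * z) = c * Im z"
  and of_real_mult_Re: "Re (of_real c * z) = c * Re z"
  by simp_all

text \<open>
  Up to the factor \<open>q1 * q3 * q4\<close>, the expression is the square of \<open>y1 - (1 - l) y3 - l y4\<close>, where
  \<open>yi\<close> is the inversion \<open>(ti, xi) / qi\<close>.
\<close>

lemma stewart_nonzero:
  fixes t1 t3 t4 q1 q3 q4 d13 d14 d34 :: complex and x1 x3 x4 :: "'a::real_inner" and l :: real
  assumes t: "Re t1 > 0" "Re t3 < 0" "Re t4 < 0" and l: "0 \<le> l" "l \<le> 1"
  defines "q1 \<equiv> t1\<^sup>2 + of_real (x1 \<bullet> x1)" and "q3 \<equiv> t3\<^sup>2 + of_real (x3 \<bullet> x3)"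
    and "q4 \<equiv> t4\<^sup>2 + of_real (x4 \<bullet> x4)"
    and "d13 \<equiv> (t1 - t3)\<^sup>2 + of_real ((norm (x1 - x3))\<^sup>2)"
    and "d14 \<equiv> (t1 - t4)\<^sup>2 + of_real ((norm (x1 - x4))\<^sup>2)"
    and "d34 \<equiv> (t3 - t4)\<^sup>2 + of_real ((norm (x3 - x4))\<^sup>2)"
  shows "(1 - l) * d13 * q4 + l * d14 * q3 - l * (1 - l) * q1 * d34 \<noteq> 0"
proof -
  \<comment> \<open>These are the coefficients of the original points in the combination of inverted
    points; \<open>T\<close> is its time and \<open>a + i b\<close> its spatial vector.\<close>
  define \<alpha> \<beta> \<gamma> where "\<alpha> = 1 / q1" and "\<beta> = - (1 - of_real l) / q3" and "\<gamma> = - of_real l / q4"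
  define T where "T = \<alpha> * t1 + \<beta> * t3 + \<gamma> * t4"
  define a where "a = Re \<alpha> *\<^sub>R x1 + Re \<beta> *\<^sub>R x3 + Re \<gamma> *\<^sub>R x4"
  define b where "b = Im \<alpha> *\<^sub>R x1 + Im \<beta> *\<^sub>R x3 + Im \<gamma> *\<^sub>R x4"
  have q1: "q1 \<notin> \<real>\<^sub>\<le>\<^sub>0" "norm (Im \<alpha> *\<^sub>R x1) < Re (\<alpha> * t1)"
    using inversion_tube[of t1 x1] t by (simp_all add: q1_def \<alpha>_def)
  \<comment> \<open>Replacing \<open>t3\<close> by \<open>- t3\<close> keeps \<open>q3\<close> and
    moves the point to positive time; the negative sign in \<open>\<beta>\<close> compensates for it
    below.\<close>
  have q3: "q3 \<notin> \<real>\<^sub>\<le>\<^sub>0" "norm (Im (1 / q3) *\<^sub>R x3) < Re (- t3 / q3)"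
    using inversion_tube[of "- t3" x3] t unfolding q3_def by simp_all
  have q4: "q4 \<notin> \<real>\<^sub>\<le>\<^sub>0" "norm (Im (1 / q4) *\<^sub>R x4) < Re (- t4 / q4)"
    using inversion_tube[of "- t4" x4] t unfolding q4_def by simp_all
  have nz: "q1 \<noteq> 0" "q3 \<noteq> 0" "q4 \<noteq> 0" using q1 q3 q4 by auto
  have \<beta>': "\<beta> = of_real (- (1 - l)) * (1 / q3)" "\<beta> * t3 = of_real (1 - l) * (- t3 / q3)"
    using nz by (simp_all add: \<beta>_def field_simps)
  have "norm (Im \<beta> *\<^sub>R x3) = (1 - l) * norm (Im (1 / q3) *\<^sub>R x3)"
    unfolding \<beta>'(1) using l by (simp only: of_real_mult_Im norm_scaleR abs_mult) simp
  moreover have "Re (\<beta> * t3) = (1 - l) * Re (- t3 / q3)"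
    unfolding \<beta>'(2) of_real_mult_Re ..
  \<comment> \<open>Only a weak inequality, since the weight \<open>1 - l\<close> may vanish;
    strictness of the sum comes from the first point.\<close>
  ultimately have B: "norm (Im \<beta> *\<^sub>R x3) \<le> Re (\<beta> * t3)"
    using mult_left_mono[OF less_imp_le[OF q3(2)], of "1 - l"] l by linarith
  have \<gamma>': "\<gamma> = of_real (- l) * (1 / q4)" "\<gamma> * t4 = of_real l * (- t4 / q4)"
    by (simp_all add: \<gamma>_def)
  have "norm (Im \<gamma> *\<^sub>R x4) = l * norm (Im (1 / q4) *\<^sub>R x4)"
    unfolding \<gamma>'(1) using l by (simp only: of_real_mult_Im norm_scaleR abs_mult) simp
  moreover have "Re (\<gamma> * t4) = l * Re (- t4 / q4)"
    unfolding \<gamma>'(2) of_real_mult_Re ..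
  ultimately have C: "norm (Im \<gamma> *\<^sub>R x4) \<le> Re (\<gamma> * t4)"
    using mult_left_mono[OF less_imp_le[OF q4(2)], of l] l by linarith
  have "norm b \<le> norm (Im \<alpha> *\<^sub>R x1) + norm (Im \<beta> *\<^sub>R x3) + norm (Im \<gamma> *\<^sub>R x4)"
    unfolding b_def by (intro norm_triangle_le add_mono) auto
  also have "\<dots> < Re T"
    using q1 B C by (simp add: T_def del: norm_scaleR)
  finally have "T\<^sup>2 + of_real (a \<bullet> a - b \<bullet> b) + 2 * \<i> * of_real (a \<bullet> b) \<noteq> 0" (is "?Y \<noteq> 0")
    by (rule tube_square_nonzero)
  \<comment> \<open>Polarization: \<open>q1 + q3 - d13\<close> is twice the bilinear product of
    points 1 and 3, and likewise for the other pairs.\<close>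
  moreover have "?Y = \<alpha>\<^sup>2 * q1 + \<beta>\<^sup>2 * q3 + \<gamma>\<^sup>2 * q4
      + \<alpha> * \<beta> * (q1 + q3 - d13) + \<alpha> * \<gamma> * (q1 + q4 - d14) + \<beta> * \<gamma> * (q3 + q4 - d34)"
  proof -
    have n: "of_real ((norm (x - y))\<^sup>2) = (of_real (x \<bullet> x + y \<bullet> y - 2 * (x \<bullet> y)) :: complex)" for x y :: 'a
      by (simp add: power2_norm_eq_inner inner_simps inner_commute)
    have "?Y = T\<^sup>2 + (of_real (a \<bullet> a - b \<bullet> b) + 2 * \<i> * of_real (a \<bullet> b))"
      by simp
    also have "\<dots> = \<alpha>\<^sup>2 * q1 + \<beta>\<^sup>2 * q3 + \<gamma>\<^sup>2 * q4
      + \<alpha> * \<beta> * (q1 + q3 - d13) + \<alpha> * \<gamma> * (q1 + q4 - d14) + \<beta> * \<gamma> * (q3 + q4 - d34)"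
      unfolding a_def b_def complex_combination_square T_def q1_def q3_def q4_def d13_def d14_def d34_def n
      by (simp add: power2_eq_square algebra_simps)
    finally show ?thesis .
  qed
  moreover have "q1 * q3 * q4 * (\<alpha>\<^sup>2 * q1 + \<beta>\<^sup>2 * q3 + \<gamma>\<^sup>2 * q4
      + \<alpha> * \<beta> * (q1 + q3 - d13) + \<alpha> * \<gamma> * (q1 + q4 - d14) + \<beta> * \<gamma> * (q3 + q4 - d34))
     = (1 - l) * d13 * q4 + l * d14 * q3 - l * (1 - l) * q1 * d34"
  proof -
    have w: "\<alpha> * q1 = 1" "\<beta> * q3 = - (1 - of_real l)" "\<gamma> * q4 = - of_real l"
      using nz by (simp_all add: \<alpha>_def \<beta>_def \<gamma>_def)
    have "q1 * q3 * q4 * (\<alpha>\<^sup>2 * q1 + \<beta>\<^sup>2 * q3 + \<gamma>\<^sup>2 * q4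
      + \<alpha> * \<beta> * (q1 + q3 - d13) + \<alpha> * \<gamma> * (q1 + q4 - d14) + \<beta> * \<gamma> * (q3 + q4 - d34))
      = (\<alpha> * q1)\<^sup>2 * (q3 * q4) + (\<beta> * q3)\<^sup>2 * (q1 * q4) + (\<gamma> * q4)\<^sup>2 * (q1 * q3)
       + (\<alpha> * q1) * (\<beta> * q3) * q4 * (q1 + q3 - d13) + (\<alpha> * q1) * (\<gamma> * q4) * q3 * (q1 + q4 - d14)
       + (\<beta> * q3) * (\<gamma> * q4) * q1 * (q3 + q4 - d34)"
      by (simp add: power2_eq_square algebra_simps)
    thus ?thesis
      unfolding w by (simp add: power2_eq_square algebra_simps)
  qed
  ultimately show ?thesis
    using nz by (metis mult_eq_0_iff)
qed

section \<open>Analytic functions of several variables\<close>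

text \<open>The condition in \<open>analytic_several_on\<close> at a single point. Closure rules are
  simplest in this form, and on an open set holding at every point gives analyticity.\<close>

definition complex_differentiable_at :: "(complex ^ 'm::finite \<Rightarrow> complex) \<Rightarrow> complex ^ 'm \<Rightarrow> bool" where
  "complex_differentiable_at f t \<longleftrightarrow>
     (\<exists>a. (f has_derivative (\<lambda>y. \<Sum>k\<in>UNIV. a $ k * y $ k)) (at t))"

lemma complex_differentiable_at_const: "complex_differentiable_at (\<lambda>t. c) t"
  unfolding complex_differentiable_at_def by (rule exI[of _ 0]) simp

lemma complex_differentiable_at_component: "complex_differentiable_at (\<lambda>t. t $ k) t"
  unfolding complex_differentiable_at_def
proof (rule exI[of _ "axis k 1"])
  have "(\<lambda>y :: complex ^ 'a. \<Sum>j\<in>UNIV. axis k 1 $ j * y $ j) = (\<lambda>y. y $ k)"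
    by (auto simp: axis_def if_distrib[of "\<lambda>x. x * _"] cong: if_cong)
  thus "((\<lambda>t. t $ k) has_derivative (\<lambda>y. \<Sum>j\<in>UNIV. axis k 1 $ j * y $ j)) (at t)"
    by (metis bounded_linear_imp_has_derivative bounded_linear_vec_nth)
qed

lemma complex_differentiable_at_add:
  assumes "complex_differentiable_at f t" "complex_differentiable_at g t"
  shows "complex_differentiable_at (\<lambda>t. f t + g t) t"
proof -
  obtain a b where "(f has_derivative (\<lambda>y. \<Sum>k\<in>UNIV. a $ k * y $ k)) (at t)"
    "(g has_derivative (\<lambda>y. \<Sum>k\<in>UNIV. b $ k * y $ k)) (at t)"
    using assms unfolding complex_differentiable_at_def by blast
  from has_derivative_add[OF this] show ?thesis
    unfolding complex_differentiable_at_def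
    by (intro exI[of _ "a + b"]) (simp add: sum.distrib algebra_simps)
qed

lemma complex_differentiable_at_mult:
  assumes "complex_differentiable_at f t" "complex_differentiable_at g t"
  shows "complex_differentiable_at (\<lambda>t. f t * g t) t"
proof -
  obtain a b where "(f has_derivative (\<lambda>y. \<Sum>k\<in>UNIV. a $ k * y $ k)) (at t)"
    "(g has_derivative (\<lambda>y. \<Sum>k\<in>UNIV. b $ k * y $ k)) (at t)"
    using assms unfolding complex_differentiable_at_def by blast
  from has_derivative_mult[OF this] show ?thesis
    unfolding complex_differentiable_at_def
    by (intro exI[of _ "\<chi> k. f t * b $ k + a $ k * g t"])
       (simp add: sum.distrib sum_distrib_left sum_distrib_right algebra_simps)
qed

lemma complex_differentiable_at_compose:
  assumes "complex_differentiable_at f t" "h field_differentiable (at (f t))"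
  shows "complex_differentiable_at (\<lambda>t. h (f t)) t"
proof -
  obtain a h' where a: "(f has_derivative (\<lambda>y. \<Sum>k\<in>UNIV. a $ k * y $ k)) (at t)"
    and h: "(h has_derivative (*) h') (at (f t))"
    using assms unfolding complex_differentiable_at_def field_differentiable_def
      has_field_derivative_def by blast
  from has_derivative_compose[OF a h] show ?thesis
    unfolding complex_differentiable_at_def
    by (intro exI[of _ "\<chi> k. h' * a $ k"]) (simp add: sum_distrib_left algebra_simps)
qed

lemma complex_differentiable_at_sum:
  assumes "\<And>i. i \<in> I \<Longrightarrow> complex_differentiable_at (f i) t"
  shows "complex_differentiable_at (\<lambda>t. \<Sum>i\<in>I. f i t) t"
  using assms
  by (induction I rule: infinite_finite_induct)
     (auto intro: complex_differentiable_at_const complex_differentiable_at_add)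

lemma complex_differentiable_at_uminus:
  "complex_differentiable_at f t \<Longrightarrow> complex_differentiable_at (\<lambda>t. - f t) t"
  using complex_differentiable_at_mult[OF complex_differentiable_at_const[of "-1"]] by simp

lemma complex_differentiable_at_diff:
  "complex_differentiable_at f t \<Longrightarrow> complex_differentiable_at g t \<Longrightarrow> complex_differentiable_at (\<lambda>t. f t - g t) t"
  using complex_differentiable_at_add[OF _ complex_differentiable_at_uminus] by fastforce

lemma complex_differentiable_at_divide:
  assumes "complex_differentiable_at f t" "complex_differentiable_at g t" "g t \<noteq> 0"
  shows "complex_differentiable_at (\<lambda>t. f t / g t) t"
proof -
  have "inverse field_differentiable (at (g t))"
    using assms(3) DERIV_inverse field_differentiable_def by blast
  thus ?thesis
    unfolding divide_inverse
    by (intro complex_differentiable_at_mult assms complex_differentiable_at_compose[of _ _ inverse])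
qed

lemma complex_differentiable_at_exp:
  "complex_differentiable_at f t \<Longrightarrow> complex_differentiable_at (\<lambda>t. exp (f t)) t"
  by (rule complex_differentiable_at_compose) (simp_all add: field_differentiable_within_exp)

lemma complex_differentiable_at_Ln:
  "complex_differentiable_at f t \<Longrightarrow> f t \<notin> \<real>\<^sub>\<le>\<^sub>0 \<Longrightarrow> complex_differentiable_at (\<lambda>t. Ln (f t)) t"
  by (rule complex_differentiable_at_compose) (simp_all add: field_differentiable_at_Ln)

lemma complex_differentiable_at_csqrt:
  "complex_differentiable_at f t \<Longrightarrow> f t \<notin> \<real>\<^sub>\<le>\<^sub>0 \<Longrightarrow> complex_differentiable_at (\<lambda>t. csqrt (f t)) t"
  by (rule complex_differentiable_at_compose) (simp_all add: field_differentiable_at_csqrt)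

lemmas complex_differentiable_at_intros =
  complex_differentiable_at_const complex_differentiable_at_component complex_differentiable_at_add
  complex_differentiable_at_mult complex_differentiable_at_diff complex_differentiable_at_divide
  complex_differentiable_at_exp complex_differentiable_at_Ln complex_differentiable_at_csqrt

lemma complex_differentiable_at_continuous:
  "complex_differentiable_at f t \<Longrightarrow> isCont f t"
  unfolding complex_differentiable_at_def using has_derivative_continuous by blast

section \<open>Complex lines, Cauchy estimates and uniform limits\<close>

lemma norm_vector_scalar_mult_complex: "norm (w *s y) = cmod w * norm (y :: complex ^ 'm::finite)"
  by (simp add: norm_vec_def norm_mult L2_set_right_distrib)

text \<open>Restriction to the line through \<open>t\<close> in direction \<open>y\<close> makes
  one-variable Cauchy theory available.\<close>

lemma has_field_derivative_along_line:
  fixes t y :: "complex ^ 'm::finite"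
  assumes "(f has_derivative (\<lambda>y. \<Sum>k\<in>UNIV. a $ k * y $ k)) (at (t + w *s y))"
  shows "((\<lambda>w. f (t + w *s y)) has_field_derivative (\<Sum>k\<in>UNIV. a $ k * y $ k)) (at w)"
proof -
  have "bounded_linear (\<lambda>w. w *s y)"
    by (rule bounded_linear_intro[of _ "norm y"])
       (auto simp: vec_eq_iff algebra_simps norm_vector_scalar_mult_complex)
  hence d: "((\<lambda>w. t + w *s y) has_derivative (\<lambda>w. w *s y)) (at w)"
    by (auto intro!: derivative_eq_intros bounded_linear_imp_has_derivative)
  have "(\<lambda>w. \<Sum>k\<in>UNIV. a $ k * (w *s y) $ k) = (*) (\<Sum>k\<in>UNIV. a $ k * y $ k)"
    by (auto simp: fun_eq_iff sum_distrib_left mult_ac)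
  with has_derivative_compose[OF d assms] show ?thesis
    unfolding has_field_derivative_def by simp
qed

text \<open>Discs of radius \<open>R / 2\<close> about points of \<open>ball 0 (R / 2)\<close> stay
  in \<open>ball 0 R\<close>, so Cauchy's estimate bounds the second derivative there by
  \<open>2 M / (R / 2)^2\<close>; Taylor's formula of order one does the rest.\<close>

lemma holomorphic_first_order_remainder:
  fixes \<phi> :: "complex \<Rightarrow> complex"
  assumes hol: "\<phi> holomorphic_on ball 0 R" and M: "\<And>w. w \<in> ball 0 R \<Longrightarrow> cmod (\<phi> w) < M"
    and w: "cmod w < R / 2"
  shows "cmod (\<phi> w - \<phi> 0 - deriv \<phi> 0 * w) \<le> 8 * M / R\<^sup>2 * (cmod w)\<^sup>2"
proof -
  have R: "R > 0" using w norm_ge_zero[of w] by linarith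
  define f where "f n = (deriv ^^ n) \<phi>" for n
  have "cmod (f 0 w - (\<Sum>i\<le>1. f i 0 * (w - 0) ^ i / fact i)) \<le> 8 * M / R\<^sup>2 * cmod (w - 0) ^ Suc 1 / fact 1"
  proof (rule complex_Taylor[of "ball 0 (R / 2)"])
    fix i x assume "x \<in> ball (0::complex) (R / 2)"
    hence x: "x \<in> ball 0 R" using R by auto
    have "f i holomorphic_on ball 0 R"
      unfolding f_def by (rule holomorphic_higher_deriv[OF hol open_ball])
    from holomorphic_derivI[OF this open_ball x]
    show "(f i has_field_derivative f (Suc i) x) (at x within ball 0 (R / 2))"
      by (simp add: f_def has_field_derivative_at_within)
  next
    fix x assume x: "x \<in> ball (0::complex) (R / 2)"
    have sub: "cball x (R / 2) \<subseteq> ball 0 R"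
    proof
      fix y assume "y \<in> cball x (R / 2)"
      hence "cmod (y - x) \<le> R / 2" "cmod x < R / 2" using x by (auto simp: dist_norm norm_minus_commute)
      thus "y \<in> ball 0 R" using norm_triangle_ineq[of "y - x" x] by simp
    qed
    hence "ball x (R / 2) \<subseteq> ball 0 R" using ball_subset_cball by blast
    hence "cmod ((deriv ^^ 2) \<phi> x) \<le> fact 2 * M / (R / 2) ^ 2"
      using R M sub holomorphic_on_imp_continuous_on[OF holomorphic_on_subset[OF hol sub]]
        holomorphic_on_subset[OF hol \<open>ball x (R / 2) \<subseteq> ball 0 R\<close>]
      by (intro Cauchy_higher_deriv_bound[of _ _ _ 0]) (auto simp: subset_iff)
    thus "cmod (f (Suc 1) x) \<le> 8 * M / R\<^sup>2"
      by (simp add: f_def numeral_2_eq_2[symmetric] power_divide del: funpow.simps)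
  qed (use R w in auto)
  thus ?thesis by (simp add: f_def algebra_simps power2_eq_square)
qed

text \<open>
  On each complex line the first-order remainder is bounded by Cauchy estimates, uniformly in the
  index and the direction, and this bound passes to the limit.
\<close>

lemma complex_differentiable_at_uniform_limit:
  fixes F :: "'i \<Rightarrow> complex ^ 'm::finite \<Rightarrow> complex"
  assumes "0 < e" and cd: "\<forall>\<^sub>F i in A. \<forall>t\<in>ball t0 e. complex_differentiable_at (F i) t"
    and lim: "uniform_limit (ball t0 e) F G A" and A: "A \<noteq> bot"
  shows "complex_differentiable_at G t0"
proof -
  have "continuous_on (ball t0 e) G"
  proof (rule uniform_limit_theorem[OF _ lim A])
    show "\<forall>\<^sub>F i in A. continuous_on (ball t0 e) (F i)"
      using cd by eventually_elim
        (auto intro!: continuous_at_imp_continuous_on complex_differentiable_at_continuous)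
  qed
  hence "isCont G t0"
    using \<open>0 < e\<close> continuous_on_interior by fastforce
  then obtain r1 where r1: "r1 > 0" "\<And>t. dist t t0 < r1 \<Longrightarrow> dist (G t) (G t0) < 1"
    unfolding continuous_at_eps_delta by (metis zero_less_one)
  define r where "r = min r1 e"
  have r: "r > 0" "r \<le> e" using r1 \<open>0 < e\<close> by (auto simp: r_def)
  \<comment> \<open>One unit allows for the variation of \<open>G\<close> near \<open>t0\<close>,
    the other for the distance from \<open>F i\<close> to \<open>G\<close>.\<close>
  define M where "M = cmod (G t0) + 2"
  have M: "\<forall>\<^sub>F i in A. \<forall>t\<in>ball t0 r. cmod (F i t) < M"
    using uniform_limitD[OF lim zero_less_one]
  proof eventually_elim
    case (elim i)
    show ?case
    proof
      fix t assume t: "t \<in> ball t0 r"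
      hence "dist (F i t) (G t) < 1" "dist (G t) (G t0) < 1"
        using elim r1(2)[of t] by (auto simp: r_def dist_commute)
      thus "cmod (F i t) < M"
        unfolding M_def using dist_triangle[of "F i t" 0 "G t"] dist_triangle[of "G t" 0 "G t0"] by simp
    qed
  qed
  define D where "D i t = (SOME a. (F i has_derivative (\<lambda>y. \<Sum>k\<in>UNIV. a $ k * y $ k)) (at t))" for i t
  have D: "\<forall>\<^sub>F i in A. \<forall>t\<in>ball t0 r. (F i has_derivative (\<lambda>y. \<Sum>k\<in>UNIV. D i t $ k * y $ k)) (at t)"
    using cd
  proof eventually_elim
    case (elim i)
    show ?case
    proof
      fix t assume "t \<in> ball t0 r"
      hence "complex_differentiable_at (F i) t" using elim r by auto
      thus "(F i has_derivative (\<lambda>y. \<Sum>k\<in>UNIV. D i t $ k * y $ k)) (at t)"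
        unfolding complex_differentiable_at_def D_def by (rule someI_ex)
    qed
  qed
  \<comment> \<open>Partial derivatives converge: on the \<open>k\<close>-th coordinate line the
    one-variable theorem on uniform limits of holomorphic functions applies, and its conclusion is
    read off at \<open>w = 0\<close>.\<close>
  have "\<exists>b. ((\<lambda>i. D i t0 $ k) \<longlongrightarrow> b) A" for k
  proof -
    let ?e = "axis k 1 :: complex ^ 'm"
    have in_ball: "t0 + w *s ?e \<in> ball t0 r" if "w \<in> cball 0 (r / 2)" for w
      using that r by (simp add: dist_norm norm_vector_scalar_mult_complex norm_axis_1)
    have ax: "(\<Sum>j\<in>UNIV. a $ j * ?e $ j) = a $ k" for a :: "complex ^ 'm"
      by (auto simp: axis_def if_distrib cong: if_cong)
    have der: "\<forall>\<^sub>F i in A. \<forall>w\<in>cball 0 (r / 2).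
        ((\<lambda>w. F i (t0 + w *s ?e)) has_field_derivative D i (t0 + w *s ?e) $ k) (at w)"
      using D
    proof eventually_elim
      case (elim i)
      show ?case
        using has_field_derivative_along_line[of "F i" "D i (t0 + w *s ?e)" t0 w ?e for w] elim in_ball
        unfolding ax by blast
    qed
    have ul: "uniform_limit (cball 0 (r / 2)) (\<lambda>i w. F i (t0 + w *s ?e)) (\<lambda>w. G (t0 + w *s ?e)) A"
    proof (rule uniform_limit_compose'[OF lim])
      show "(\<lambda>w. t0 + w *s ?e) \<in> cball 0 (r / 2) \<rightarrow> ball t0 e"
        using in_ball subset_ball[OF r(2), of t0] by blast
    qed
    have ev: "\<forall>\<^sub>F i in A. continuous_on (cball 0 (r / 2)) (\<lambda>w. F i (t0 + w *s ?e)) \<and>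
        (\<forall>w\<in>ball 0 (r / 2). ((\<lambda>w. F i (t0 + w *s ?e)) has_field_derivative D i (t0 + w *s ?e) $ k) (at w))"
      using der by eventually_elim
        (auto intro!: continuous_at_imp_continuous_on intro: DERIV_isCont)
    obtain g' where "\<And>w. w \<in> ball 0 (r / 2) \<Longrightarrow> ((\<lambda>i. D i (t0 + w *s ?e) $ k) \<longlongrightarrow> g' w) A"
      using has_complex_derivative_uniform_limit[OF ev ul A] r by (metis half_gt_zero)
    from this[of 0] r show ?thesis by auto
  qed
  then obtain b where b: "\<And>k. ((\<lambda>i. D i t0 $ k) \<longlongrightarrow> b k) A" by metis
  define a where "a = (\<chi> k. b k)"
  \<comment> \<open>The line in direction \<open>y\<close> stays in the ball for
    \<open>cmod w < r / norm y\<close>. As this radius exceeds 2, the remainder estimate may be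
    evaluated at \<open>w = 1\<close>.\<close>
  have rem: "cmod (G (t0 + y) - G t0 - (\<Sum>k\<in>UNIV. a $ k * y $ k)) \<le> 8 * M / r\<^sup>2 * (norm y)\<^sup>2"
    if y: "norm y < r / 2" "y \<noteq> 0" for y
  proof (rule tendsto_upperbound[OF _ _ A])
    have "t0 \<in> ball t0 e" "t0 + y \<in> ball t0 e" using y r \<open>0 < e\<close> by (auto simp: dist_norm)
    thus "((\<lambda>i. cmod (F i (t0 + y) - F i t0 - (\<Sum>k\<in>UNIV. D i t0 $ k * y $ k)))
        \<longlongrightarrow> cmod (G (t0 + y) - G t0 - (\<Sum>k\<in>UNIV. a $ k * y $ k))) A"
      unfolding a_def using tendsto_uniform_limitI[OF lim]
      by (auto intro!: tendsto_intros b)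
    show "\<forall>\<^sub>F i in A. cmod (F i (t0 + y) - F i t0 - (\<Sum>k\<in>UNIV. D i t0 $ k * y $ k))
        \<le> 8 * M / r\<^sup>2 * (norm y)\<^sup>2"
      using D M
    proof eventually_elim
      case (elim i)
      define \<phi> where "\<phi> w = F i (t0 + w *s y)" for w
      have in_ball: "t0 + w *s y \<in> ball t0 r" if "w \<in> ball 0 (r / norm y)" for w
        using that y r by (simp add: dist_norm norm_vector_scalar_mult_complex field_simps)
      have der: "(\<phi> has_field_derivative (\<Sum>k\<in>UNIV. D i (t0 + w *s y) $ k * y $ k)) (at w)"
        if "w \<in> ball 0 (r / norm y)" for w
        unfolding \<phi>_def using elim(1) in_ball[OF that] by (intro has_field_derivative_along_line) blast
      have "cmod (\<phi> 1 - \<phi> 0 - deriv \<phi> 0 * 1) \<le> 8 * M / (r / norm y)\<^sup>2 * (cmod 1)\<^sup>2"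
      proof (rule holomorphic_first_order_remainder)
        show "\<phi> holomorphic_on ball 0 (r / norm y)"
          unfolding holomorphic_on_def field_differentiable_def
          using has_field_derivative_at_within[OF der] by blast
        show "cmod (\<phi> w) < M" if "w \<in> ball 0 (r / norm y)" for w
          unfolding \<phi>_def using elim(2) in_ball[OF that] by blast
      qed (use y in \<open>simp add: field_simps\<close>)
      moreover have "deriv \<phi> 0 = (\<Sum>k\<in>UNIV. D i t0 $ k * y $ k)"
        using DERIV_imp_deriv[OF der[of 0]] r y by simp
      ultimately show ?case by (simp add: \<phi>_def power_divide)
    qed
  qed
  have "(G has_derivative (\<lambda>y. \<Sum>k\<in>UNIV. a $ k * y $ k)) (at t0)"
  proof (rule has_derivativeI_sandwich[of "r / 2" _ _ _ _ "\<lambda>t. 8 * M / r\<^sup>2 * norm (t - t0)"])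
    show "bounded_linear (\<lambda>y. \<Sum>k\<in>UNIV. a $ k * y $ k)"
      by (intro bounded_linear_sum bounded_linear_const_mult bounded_linear_vec_nth)
    show "((\<lambda>t. 8 * M / r\<^sup>2 * norm (t - t0)) \<longlongrightarrow> 0) (at t0)"
      using r by (auto intro!: tendsto_eq_intros)
    fix t assume "t \<noteq> t0" "dist t t0 < r / 2"
    with rem[of "t - t0"] show "norm (G t - G t0 - (\<Sum>k\<in>UNIV. a $ k * (t - t0) $ k)) / norm (t - t0)
        \<le> 8 * M / r\<^sup>2 * norm (t - t0)"
      using r by (simp add: dist_norm field_simps power2_eq_square del: vector_minus_component)
  qed (use r in simp)
  thus ?thesis unfolding complex_differentiable_at_def by blast
qed

section \<open>Roots of the cross-ratio equation on the ordered domain\<close>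

lemma xsq_notin_nonpos_Reals:
  assumes "Re (fst (X $ i)) > Re (fst (X $ j))"
  shows "xsq X i j \<notin> \<real>\<^sub>\<le>\<^sub>0"
  using inversion_tube(1)[of "fst (X $ i) - fst (X $ j)" "snd (X $ i) - snd (X $ j)"] assms
  by (simp add: xsq_def dot_square_norm)

text \<open>This is what makes the principal logarithms of these six squares analytic on the
  domain.\<close>

lemma xsq_ordered_domain:
  assumes "X \<in> ordered_domain"
  shows "xsq X 1 2 \<notin> \<real>\<^sub>\<le>\<^sub>0" "xsq X 3 4 \<notin> \<real>\<^sub>\<le>\<^sub>0" "xsq X 1 3 \<notin> \<real>\<^sub>\<le>\<^sub>0"
    "xsq X 2 4 \<notin> \<real>\<^sub>\<le>\<^sub>0" "xsq X 1 4 \<notin> \<real>\<^sub>\<le>\<^sub>0" "xsq X 2 3 \<notin> \<real>\<^sub>\<le>\<^sub>0"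
  using assms by (auto intro!: xsq_notin_nonpos_Reals simp: ordered_domain_def)

lemma xsq_ordered_domain_nonzero:
  assumes "X \<in> ordered_domain"
  shows "xsq X 1 2 \<noteq> 0" "xsq X 3 4 \<noteq> 0" "xsq X 1 3 \<noteq> 0" "xsq X 2 4 \<noteq> 0"
    "xsq X 1 4 \<noteq> 0" "xsq X 2 3 \<noteq> 0"
  using xsq_ordered_domain[OF assms] by (metis nonpos_Reals_zero_I)+

lemma xsq_commute: "xsq X i j = xsq X j i"
  by (simp add: xsq_def norm_minus_commute power2_commute)

lemma z_notin_branch_cut:
  assumes X: "X \<in> ordered_domain" and z: "is_z_zbar X z zb"
  shows "z \<notin> branch_cut"
proof
  assume "z \<in> branch_cut"
  then obtain s :: real where s: "z = of_real s" "s \<ge> 1"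
    by (auto simp: branch_cut_def)
  let ?x = "xsq X"
  note nz = xsq_ordered_domain_nonzero[OF X]
  \<comment> \<open>With this \<open>l\<close>, the Stewart expression divided by
    \<open>x13 * x24\<close> is \<open>(1 - l) + l v - l (1 - l) u\<close>. It vanishes for
    \<open>u = s zb\<close>, \<open>v = (1 - s) (1 - zb)\<close>, whatever \<open>zb\<close>
    is.\<close>
  define l where "l = 1 / s"
  have l: "0 \<le> l" "l \<le> 1" using s by (auto simp: l_def)
  \<comment> \<open>Translation puts the second point, the centre of the inversion, at the
    origin.\<close>
  define x where "x k = snd (X $ k) - snd (X $ 2)" for k
  define t where "t k = fst (X $ k) - fst (X $ 2)" for k
  have xx: "x i - x j = snd (X $ i) - snd (X $ j)" "t i - t j = fst (X $ i) - fst (X $ j)" for i j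
    by (simp_all add: x_def t_def)
  have q: "(t k)\<^sup>2 + of_real (x k \<bullet> x k) = ?x k 2" for k
    by (simp add: xsq_def x_def t_def dot_square_norm)
  have d: "(t i - t j)\<^sup>2 + of_real ((norm (x i - x j))\<^sup>2) = ?x i j" for i j
    by (simp add: xsq_def xx)
  have "(1 - of_real l) * ?x 1 3 * ?x 4 2 + of_real l * ?x 1 4 * ?x 3 2
      - of_real l * (1 - of_real l) * ?x 1 2 * ?x 3 4 \<noteq> 0"
    using stewart_nonzero[of "t 1" "t 3" "t 4" l "x 1" "x 3" "x 4"] l X
    unfolding q d by (simp add: t_def ordered_domain_def)
  hence ne: "(1 - of_real l) * (?x 1 3 * ?x 2 4) + of_real l * (?x 1 4 * ?x 2 3)
      - of_real l * (1 - of_real l) * (?x 1 2 * ?x 3 4) \<noteq> 0"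
    by (simp add: xsq_commute[of X 4 2] xsq_commute[of X 3 2] mult.assoc)
  have uv: "cross_u X = of_real s * zb" "cross_v X = (1 - of_real s) * (1 - zb)"
    using z s by (simp_all add: is_z_zbar_def)
  have eqs: "?x 1 2 * ?x 3 4 = of_real s * zb * (?x 1 3 * ?x 2 4)"
    "?x 1 4 * ?x 2 3 = (1 - of_real s) * (1 - zb) * (?x 1 3 * ?x 2 4)"
    using uv nz by (simp_all add: cross_u_def cross_v_def divide_eq_eq)
  have "(1 - of_real l) * (?x 1 3 * ?x 2 4) + of_real l * (?x 1 4 * ?x 2 3)
      - of_real l * (1 - of_real l) * (?x 1 2 * ?x 3 4)
    = ((1 - of_real l) + of_real l * ((1 - of_real s) * (1 - zb))
      - of_real l * (1 - of_real l) * (of_real s * zb)) * (?x 1 3 * ?x 2 4)"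
    unfolding eqs by (simp add: algebra_simps)
  also have "(1 - of_real l) + of_real l * ((1 - of_real s) * (1 - zb))
      - of_real l * (1 - of_real l) * (of_real s * zb) = 0"
  proof -
    have "of_real l * of_real s = (1 :: complex)"
      using s by (simp add: l_def)
    hence "of_real l * ((1 - of_real s) * (1 - zb)) = (of_real l - 1) * (1 - zb)"
      "of_real l * (1 - of_real l) * (of_real s * zb) = (1 - of_real l) * zb"
      by (simp_all add: mult.assoc[symmetric] left_diff_distrib right_diff_distrib)
    thus ?thesis by (simp add: algebra_simps)
  qed
  finally show False using ne by simp
qed

section \<open>The right half-plane and the map \<open>rho\<close>\<close>

lemma branch_cut_iff: "z \<in> branch_cut \<longleftrightarrow> 1 - z \<in> \<real>\<^sub>\<le>\<^sub>0"
proof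
  assume "1 - z \<in> \<real>\<^sub>\<le>\<^sub>0"
  then obtain r where "1 - z = of_real r" "r \<le> 0"
    by (auto elim!: nonpos_Reals_cases)
  hence "z = of_real (1 - r)" "1 \<le> 1 - r"
    by (simp_all add: algebra_simps)
  thus "z \<in> branch_cut" unfolding branch_cut_def by (metis atLeast_iff image_eqI)
qed (auto simp: branch_cut_def complex_nonpos_Reals_iff)

lemma Re_csqrt_pos:
  assumes "w \<notin> \<real>\<^sub>\<le>\<^sub>0"
  shows "Re (csqrt w) > 0"
proof (rule ccontr)
  assume "\<not> Re (csqrt w) > 0"
  hence "Re (csqrt w) = 0" using csqrt_principal[of w] by auto
  hence "Re ((csqrt w)\<^sup>2) \<le> 0" "Im ((csqrt w)\<^sup>2) = 0"
    by (simp_all add: power2_eq_square)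
  thus False using assms by (simp add: complex_nonpos_Reals_iff)
qed

text \<open>Two arguments of modulus below pi / 2 have a sum of modulus below pi.\<close>

lemma mult_notin_nonpos_Reals:
  assumes "Re p > 0" "Re q > 0"
  shows "p * q \<notin> \<real>\<^sub>\<le>\<^sub>0"
proof
  assume "p * q \<in> \<real>\<^sub>\<le>\<^sub>0"
  hence re: "Re p * Re q \<le> Im p * Im q" and im: "Re p * Im q = - (Im p * Re q)"
    by (auto simp: complex_nonpos_Reals_iff)
  have "0 < Re p * (Re p * Re q)" using assms by simp
  also have "\<dots> \<le> Re p * (Im p * Im q)" using re assms by (intro mult_left_mono) auto
  also have "\<dots> = Im p * (Re p * Im q)" by simp
  also have "\<dots> = - ((Im p)\<^sup>2 * Re q)" unfolding im by (simp add: power2_eq_square)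
  also have "\<dots> \<le> 0" using assms by simp
  finally show False by simp
qed

lemma one_plus_nonzero:
  assumes "Re a > 0"
  shows "1 + a \<noteq> 0"
  using assms by (auto simp: complex_eq_iff)

lemma rho_eq:
  assumes "z \<notin> branch_cut"
  shows "rho z = (1 - csqrt (1 - z)) / (1 + csqrt (1 - z))"
proof -
  define a where "a = csqrt (1 - z)"
  have "Re a > 0" unfolding a_def using assms branch_cut_iff Re_csqrt_pos by blast
  hence "1 + a \<noteq> 0" by (rule one_plus_nonzero)
  moreover have "z = (1 - a) * (1 + a)"
    by (simp add: a_def algebra_simps flip: power2_eq_square)
  ultimately show ?thesis
    unfolding rho_def a_def[symmetric]
    \<comment> \<open>The case \<open>a = 1\<close> is \<open>z = 0\<close>, where
      \<open>rho\<close> divides by zero and takes the value 0, as does the right side.\<close>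
    by (cases "a = 1") (simp_all add: power2_eq_square)
qed

text \<open>The Cayley transform sends the right half-plane into the unit disc.\<close>

lemma norm_rho_less_1:
  assumes "z \<notin> branch_cut"
  shows "cmod (rho z) < 1"
proof -
  define a where "a = csqrt (1 - z)"
  have a: "Re a > 0" unfolding a_def using assms branch_cut_iff Re_csqrt_pos by blast
  hence "(cmod (1 - a))\<^sup>2 < (cmod (1 + a))\<^sup>2"
    unfolding cmod_power2 by (simp add: power2_eq_square algebra_simps)
  hence "cmod (1 - a) < cmod (1 + a)"
    by (rule power2_less_imp_less) simp
  thus ?thesis
    unfolding rho_eq[OF assms] a_def[symmetric] by (simp add: norm_divide divide_less_eq)
qed

lemma isCont_csqrt_1_minus:
  assumes "z \<notin> branch_cut"
  shows "isCont (\<lambda>z. csqrt (1 - z)) z"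
  using assms branch_cut_iff by (intro continuous_intros isCont_o2[where f = "\<lambda>z. 1 - z" and g = csqrt] continuous_at_csqrt) auto

lemma isCont_rho:
  assumes "z \<notin> branch_cut"
  shows "isCont rho z"
proof -
  have "open (- branch_cut)"
  proof -
    have "- branch_cut = (\<lambda>z. 1 - z) -` (- \<real>\<^sub>\<le>\<^sub>0)"
      by (auto simp: branch_cut_iff)
    thus ?thesis
      using closed_nonpos_Reals_complex by (simp add: open_Compl continuous_open_vimage)
  qed
  moreover have "continuous_on (- branch_cut) rho"
  proof (rule continuous_on_eq)
    show "continuous_on (- branch_cut) (\<lambda>z. (1 - csqrt (1 - z)) / (1 + csqrt (1 - z)))"
    proof (intro continuous_intros continuous_at_imp_continuous_on ballI)
      fix z assume "z \<in> - branch_cut"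
      thus "1 + csqrt (1 - z) \<noteq> 0"
        using branch_cut_iff Re_csqrt_pos one_plus_nonzero by blast
    qed (auto intro: isCont_csqrt_1_minus)
  qed (simp add: rho_eq)
  ultimately show ?thesis
    using assms by (simp add: continuous_on_eq_continuous_at)
qed

section \<open>The two roots and continuity of their symmetric functions\<close>

text \<open>\<open>z_plus\<close> and \<open>z_minus\<close> are the roots of
  \<open>Z^2 - (1 + u - v) Z + u\<close>. The labelling follows the principal root of the
  discriminant and can jump, so continuity is claimed only for symmetric functions of the
  pair.\<close>

definition z_plus :: "'n::finite cconfig \<Rightarrow> complex" where
  "z_plus X = (1 + cross_u X - cross_v X + csqrt ((1 + cross_u X - cross_v X)\<^sup>2 - 4 * cross_u X)) / 2"

definition z_minus :: "'n::finite cconfig \<Rightarrow> complex" where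
  "z_minus X = (1 + cross_u X - cross_v X - csqrt ((1 + cross_u X - cross_v X)\<^sup>2 - 4 * cross_u X)) / 2"

lemma is_z_zbar_z_plus_minus: "is_z_zbar X (z_plus X) (z_minus X)"
proof -
  have a: "z_plus X + z_minus X = 1 + cross_u X - cross_v X"
    by (simp add: z_plus_def z_minus_def field_simps)
  have "z_plus X * z_minus X =
     ((1 + cross_u X - cross_v X)\<^sup>2 - (csqrt ((1 + cross_u X - cross_v X)\<^sup>2 - 4 * cross_u X))\<^sup>2) / 4"
    unfolding z_plus_def z_minus_def by (simp add: power2_eq_square field_simps)
  hence b: "z_plus X * z_minus X = cross_u X" by simp
  have "(1 - z_plus X) * (1 - z_minus X) = 1 - (z_plus X + z_minus X) + z_plus X * z_minus X"
    by (simp add: algebra_simps)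
  thus ?thesis unfolding is_z_zbar_def using a b by simp
qed

lemma is_z_zbar_sym: "is_z_zbar X z zb \<Longrightarrow> is_z_zbar X zb z"
  by (simp add: is_z_zbar_def mult.commute)

lemma z_plus_notin_branch_cut: "X \<in> ordered_domain \<Longrightarrow> z_plus X \<notin> branch_cut"
  and z_minus_notin_branch_cut: "X \<in> ordered_domain \<Longrightarrow> z_minus X \<notin> branch_cut"
  using z_notin_branch_cut is_z_zbar_z_plus_minus is_z_zbar_sym by blast+

lemma continuous_on_xsq: "continuous_on S (\<lambda>X. xsq X i j)"
  unfolding xsq_def by (intro continuous_intros)

lemma continuous_on_cross:
  "continuous_on ordered_domain cross_u" "continuous_on ordered_domain cross_v"
  unfolding cross_u_def cross_v_def
  by (intro continuous_intros continuous_on_xsq; simp add: xsq_ordered_domain_nonzero)+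

text \<open>
  The square root of the discriminant is discontinuous, but a suitable choice of sign makes it
  converge, and symmetric functions do not see the sign.
\<close>

lemma continuous_on_symmetric_roots:
  fixes \<phi> :: "complex \<times> complex \<Rightarrow> 'b::topological_space"
  assumes sym: "\<And>a b. \<phi> (a, b) = \<phi> (b, a)"
    and cont: "\<And>a b. a \<notin> branch_cut \<Longrightarrow> b \<notin> branch_cut \<Longrightarrow> isCont \<phi> (a, b)"
  shows "continuous_on ordered_domain (\<lambda>X. \<phi> (z_plus X, z_minus X))"
  unfolding continuous_on_def
proof
  fix X0 :: "'n::finite cconfig" assume X0: "X0 \<in> ordered_domain"
  let ?F = "at X0 within ordered_domain"
  define P where "P X = 1 + cross_u X - cross_v X" for X :: "'n::finite cconfig"
  define T where "T X = (P X)\<^sup>2 - 4 * cross_u X" for X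
  define w where "w X = csqrt (T X)" for X
  \<comment> \<open>The sign of the root that lies nearer to \<open>w X0\<close>. The square of the
    smaller distance is at most the product of both distances, which is
    \<open>cmod (T X - T X0)\<close>.\<close>
  define \<sigma> where "\<sigma> X = (if cmod (w X - w X0) \<le> cmod (w X + w X0) then w X else - w X)" for X
  have P: "continuous_on ordered_domain P" and T: "continuous_on ordered_domain T"
    unfolding T_def P_def by (intro continuous_intros continuous_on_cross)+
  have bound: "(cmod (\<sigma> X - w X0))\<^sup>2 \<le> cmod (T X - T X0)" for X
  proof -
    have "T X - T X0 = (w X)\<^sup>2 - (w X0)\<^sup>2" by (simp add: w_def)
    also have "\<dots> = (w X - w X0) * (w X + w X0)" by (simp add: power2_eq_square algebra_simps)
    finally have e: "cmod (T X - T X0) = cmod (w X - w X0) * cmod (w X + w X0)"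
      by (simp add: norm_mult)
    have "cmod (- w X - w X0) = cmod (w X + w X0)"
      by (metis minus_add_distrib norm_minus_cancel uminus_add_conv_diff add.commute)
    thus ?thesis unfolding e \<sigma>_def by (auto simp: power2_eq_square intro: mult_mono)
  qed
  have "((\<lambda>X. cmod (T X - T X0)) \<longlongrightarrow> 0) ?F"
    using T X0 by (simp add: continuous_on_def tendsto_norm_zero LIM_zero)
  hence "((\<lambda>X. (cmod (\<sigma> X - w X0))\<^sup>2) \<longlongrightarrow> 0) ?F"
    by (rule tendsto_0_le[where K = 1]) (simp add: bound)
  hence "((\<lambda>X. sqrt ((cmod (\<sigma> X - w X0))\<^sup>2)) \<longlongrightarrow> sqrt 0) ?F"
    by (intro tendsto_real_sqrt)
  hence \<sigma>: "(\<sigma> \<longlongrightarrow> w X0) ?F"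
    by (simp add: tendsto_norm_zero_iff LIM_zero_iff)
  have P0: "(P \<longlongrightarrow> P X0) ?F" using P X0 by (simp add: continuous_on_def)
  have eq: "\<phi> (z_plus X, z_minus X) = \<phi> ((P X + \<sigma> X) / 2, (P X - \<sigma> X) / 2)" for X
    unfolding z_plus_def z_minus_def \<sigma>_def w_def T_def P_def using sym by auto
  have eq0: "(z_plus X0, z_minus X0) = ((P X0 + w X0) / 2, (P X0 - w X0) / 2)"
    unfolding z_plus_def z_minus_def w_def T_def P_def by simp
  have "((\<lambda>X. ((P X + \<sigma> X) / 2, (P X - \<sigma> X) / 2)) \<longlongrightarrow> (z_plus X0, z_minus X0)) ?F"
    unfolding eq0 by (intro tendsto_intros P0 \<sigma>) auto
  from isCont_tendsto_compose[OF cont[OF z_plus_notin_branch_cut[OF X0] z_minus_notin_branch_cut[OF X0]] this]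
  show "((\<lambda>X. \<phi> (z_plus X, z_minus X)) \<longlongrightarrow> \<phi> (z_plus X0, z_minus X0)) ?F"
    unfolding eq .
qed

section \<open>Analytic symmetric functions of \<open>\<rho>\<close> and \<open>\<rho>b\<close>\<close>

definition sqrt_v :: "'n::finite cconfig \<Rightarrow> complex" where
  "sqrt_v X = exp ((Ln (xsq X 1 4) + Ln (xsq X 2 3) - Ln (xsq X 1 3) - Ln (xsq X 2 4)) / 2)"

text \<open>This is \<open>(1 + a) * (1 + b)\<close> expanded, the root being \<open>a + b\<close>
  and \<open>sqrt_v\<close> being \<open>a * b\<close>, as shown in
  \<open>csqrt_arg_eq\<close>.\<close>

definition rho_denom :: "'n::finite cconfig \<Rightarrow> complex" where
  "rho_denom X = 1 + csqrt (1 - cross_u X + cross_v X + 2 * sqrt_v X) + sqrt_v X"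

text \<open>From \<open>u = (1 - a^2) (1 - b^2)\<close> the product of the two \<open>rho\<close>
  values is \<open>u / rho_denom^2\<close>; this is a logarithm of that quotient, assembled from
  principal ones so as to be analytic.\<close>

definition log_rho_prod :: "'n::finite cconfig \<Rightarrow> complex" where
  "log_rho_prod X = Ln (xsq X 1 2) + Ln (xsq X 3 4) - Ln (xsq X 1 3) - Ln (xsq X 2 4) - 2 * Ln (rho_denom X)"

text \<open>This is \<open>(1 - a) / (1 + a) + (1 - b) / (1 + b)\<close> over the common
  denominator.\<close>

definition rho_sum :: "'n::finite cconfig \<Rightarrow> complex" where
  "rho_sum X = 2 * (1 - sqrt_v X) / rho_denom X"

lemma sqrt_v_squared:
  assumes "X \<in> ordered_domain"
  shows "(sqrt_v X)\<^sup>2 = cross_v X"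
proof -
  define E where "E = Ln (xsq X 1 4) + Ln (xsq X 2 3) - Ln (xsq X 1 3) - Ln (xsq X 2 4)"
  have "(sqrt_v X)\<^sup>2 = exp E"
    unfolding sqrt_v_def E_def[symmetric] exp_double[symmetric] by simp
  also have "\<dots> = cross_v X"
    using xsq_ordered_domain_nonzero[OF assms]
    by (simp add: E_def exp_diff exp_add cross_v_def)
  finally show ?thesis .
qed

lemma sqrt_v_nonzero: "sqrt_v X \<noteq> 0"
  by (simp add: sqrt_v_def)

lemma continuous_on_sqrt_v: "continuous_on ordered_domain sqrt_v"
  unfolding sqrt_v_def
  by (intro continuous_intros continuous_on_xsq) (auto simp: xsq_ordered_domain)


section \<open>Positivity at real configurations\<close>

lemma xsq_complexify:
  assumes "complexify Y \<in> ordered_domain"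
  shows "\<exists>r>0. xsq (complexify Y) 1 2 = of_real r" "\<exists>r>0. xsq (complexify Y) 3 4 = of_real r"
    "\<exists>r>0. xsq (complexify Y) 1 3 = of_real r" "\<exists>r>0. xsq (complexify Y) 2 4 = of_real r"
    "\<exists>r>0. xsq (complexify Y) 1 4 = of_real r" "\<exists>r>0. xsq (complexify Y) 2 3 = of_real r"
proof -
  have *: "\<exists>r>0. xsq (complexify Y) i j = of_real r" if "xsq (complexify Y) i j \<notin> \<real>\<^sub>\<le>\<^sub>0" for i j
  proof -
    obtain r where r: "xsq (complexify Y) i j = of_real r"
      by (simp add: xsq_def complexify_def flip: of_real_diff of_real_power of_real_add)
    with that have "\<not> r \<le> 0" by auto
    with r show ?thesis by (auto simp: not_le)
  qed
  show "\<exists>r>0. xsq (complexify Y) 1 2 = of_real r" "\<exists>r>0. xsq (complexify Y) 3 4 = of_real r"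
    "\<exists>r>0. xsq (complexify Y) 1 3 = of_real r" "\<exists>r>0. xsq (complexify Y) 2 4 = of_real r"
    "\<exists>r>0. xsq (complexify Y) 1 4 = of_real r" "\<exists>r>0. xsq (complexify Y) 2 3 = of_real r"
    using xsq_ordered_domain[OF assms] by (auto intro!: *)
qed

lemma complexify_sqrt_v_pos:
  assumes "complexify Y \<in> ordered_domain"
  shows "\<exists>r>0. sqrt_v (complexify Y) = of_real r"
proof -
  obtain a b c d where "a > 0" "xsq (complexify Y) 1 4 = of_real a" "b > 0" "xsq (complexify Y) 2 3 = of_real b"
    "c > 0" "xsq (complexify Y) 1 3 = of_real c" "d > 0" "xsq (complexify Y) 2 4 = of_real d"
    using xsq_complexify[OF assms] by blast
  hence "sqrt_v (complexify Y) = of_real (exp ((ln a + ln b - ln c - ln d) / 2))"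
    unfolding sqrt_v_def by (simp add: Ln_of_real flip: exp_of_real)
  thus ?thesis by (metis exp_gt_zero)
qed

lemma complexify_cross_Reals:
  assumes "complexify Y \<in> ordered_domain"
  shows "cross_u (complexify Y) \<in> \<real>" "cross_v (complexify Y) \<in> \<real>"
  using xsq_complexify[OF assms] unfolding cross_u_def cross_v_def by auto

lemma real_or_conjugate_pair:
  assumes "z + zb \<in> \<real>" "z * zb \<in> \<real>"
  shows "z \<in> \<real> \<and> zb \<in> \<real> \<or> zb = cnj z"
proof -
  have im: "Im zb = - Im z" using assms(1) by (simp add: complex_is_Real_iff)
  hence "Im z * (Re zb - Re z) = 0"
    using assms(2) by (simp add: complex_is_Real_iff algebra_simps)
  hence "Im z = 0 \<or> Re zb = Re z" by simp
  thus ?thesis using im by (auto simp: complex_is_Real_iff complex_eq_iff)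
qed

text \<open>Real cross-ratios leave two cases. Either both roots are real and below 1, and the
  square roots are positive, or they are conjugate, and so are the square roots, with positive real
  part.\<close>

lemma complexify_roots_pos:
  assumes X: "complexify Y \<in> ordered_domain"
    and z: "is_z_zbar (complexify Y) z zb"
  shows "\<exists>r>0. csqrt (1 - z) * csqrt (1 - zb) = of_real r"
    and "\<exists>r>0. csqrt (1 - z) + csqrt (1 - zb) = of_real r"
proof -
  have cut: "1 - z \<notin> \<real>\<^sub>\<le>\<^sub>0" "1 - zb \<notin> \<real>\<^sub>\<le>\<^sub>0"
    using z_notin_branch_cut[OF X] z is_z_zbar_sym branch_cut_iff by blast+
  have uv: "cross_u (complexify Y) = z * zb" "cross_v (complexify Y) = (1 - z) * (1 - zb)"
    using z by (simp_all add: is_z_zbar_def)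
  have "z + zb = 1 + z * zb - (1 - z) * (1 - zb)" by (simp add: algebra_simps)
  also have "\<dots> \<in> \<real>"
    using complexify_cross_Reals[OF X] unfolding uv by simp
  finally have "z + zb \<in> \<real>" .
  moreover have "z * zb \<in> \<real>"
    using complexify_cross_Reals(1)[OF X] uv by simp
  ultimately consider "z \<in> \<real>" "zb \<in> \<real>" | "zb = cnj z"
    using real_or_conjugate_pair by blast
  hence "(\<exists>r>0. csqrt (1 - z) * csqrt (1 - zb) = of_real r) \<and> (\<exists>r>0. csqrt (1 - z) + csqrt (1 - zb) = of_real r)"
  proof cases
    case 1
    then obtain a b where ab: "z = of_real a" "zb = of_real b" by (auto elim!: Reals_cases)
    hence "a < 1" "b < 1" using cut by (auto simp: complex_nonpos_Reals_iff)
    have "1 - z = of_real (1 - a)" "1 - zb = of_real (1 - b)" using ab by simp_all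
    hence "csqrt (1 - z) = of_real (sqrt (1 - a))" "csqrt (1 - zb) = of_real (sqrt (1 - b))"
      using \<open>a < 1\<close> \<open>b < 1\<close> by (simp_all only: csqrt_of_real_nonneg Re_complex_of_real Im_complex_of_real diff_ge_0_iff_ge less_imp_le)
    moreover have "sqrt (1 - a) > 0" "sqrt (1 - b) > 0" using \<open>a < 1\<close> \<open>b < 1\<close> by simp_all
    ultimately show ?thesis by (metis of_real_add of_real_mult add_pos_pos mult_pos_pos)
  next
    case 2
    have pos: "Re (csqrt (1 - z)) > 0" by (rule Re_csqrt_pos[OF cut(1)])
    have cs: "csqrt (1 - zb) = cnj (csqrt (1 - z))"
    proof (rule csqrt_unique)
      show "(cnj (csqrt (1 - z)))\<^sup>2 = 1 - zb"
        unfolding complex_cnj_power[symmetric] power2_csqrt using 2 by simp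
    qed (use pos in simp)
    have "csqrt (1 - z) \<noteq> 0" using pos by auto
    hence "(cmod (csqrt (1 - z)))\<^sup>2 > 0" by simp
    moreover have "csqrt (1 - z) * csqrt (1 - zb) = of_real ((cmod (csqrt (1 - z)))\<^sup>2)"
      unfolding cs by (rule complex_norm_square[symmetric])
    moreover have "csqrt (1 - z) + csqrt (1 - zb) = of_real (2 * Re (csqrt (1 - z)))"
      unfolding cs by (rule complex_add_cnj)
    moreover have "2 * Re (csqrt (1 - z)) > 0" using pos by simp
    ultimately show ?thesis by blast
  qed
  thus "\<exists>r>0. csqrt (1 - z) * csqrt (1 - zb) = of_real r"
    and "\<exists>r>0. csqrt (1 - z) + csqrt (1 - zb) = of_real r" by blast+
qed

section \<open>Identification of the branches\<close>

lemma connected_ordered_domain: "connected (ordered_domain :: 'n::finite cconfig set)"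
proof (rule convex_connected)
  have half: "convex {X :: 'n cconfig. Re (fst (X $ i)) > Re (fst (X $ j))}" for i j
  proof -
    have "linear (\<lambda>X :: 'n cconfig. Re (fst (X $ i)) - Re (fst (X $ j)))"
      by (rule linearI) (simp_all add: algebra_simps)
    from convex_linear_vimage[OF this convex_real_interval(3)[of 0]]
    show ?thesis by (simp add: vimage_def)
  qed
  show "convex (ordered_domain :: 'n cconfig set)"
    unfolding ordered_domain_def Collect_conj_eq by (intro convex_Int half)
qed

text \<open>
  Both sides are square roots of \<open>v\<close>, continuous on the connected domain, and they
  agree at a real configuration.
\<close>

lemma sqrt_v_eq:
  assumes X: "X \<in> ordered_domain"
  shows "sqrt_v X = csqrt (1 - z_plus X) * csqrt (1 - z_minus X)"
proof -
  define \<kappa> :: "'a cconfig \<Rightarrow> complex"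
    where "\<kappa> X = csqrt (1 - z_plus X) * csqrt (1 - z_minus X) / sqrt_v X" for X
  define \<phi> where "\<phi> = (\<lambda>(a, b). csqrt (1 - a) * csqrt (1 - b))"
  have "continuous_on ordered_domain (\<lambda>X :: 'a cconfig. \<phi> (z_plus X, z_minus X))"
  proof (rule continuous_on_symmetric_roots)
    fix a b assume ab: "a \<notin> branch_cut" "b \<notin> branch_cut"
    have "((\<lambda>x. csqrt (1 - fst x)) \<longlongrightarrow> csqrt (1 - a)) (at (a, b))"
      "((\<lambda>x. csqrt (1 - snd x)) \<longlongrightarrow> csqrt (1 - b)) (at (a, b))"
      using isCont_tendsto_compose[OF isCont_csqrt_1_minus[OF ab(1)], of fst "at (a, b)"]
        isCont_tendsto_compose[OF isCont_csqrt_1_minus[OF ab(2)], of snd "at (a, b)"]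
        tendsto_fst[OF tendsto_ident_at, of "(a, b)"] tendsto_snd[OF tendsto_ident_at, of "(a, b)"] by simp_all
    thus "isCont \<phi> (a, b)"
      unfolding \<phi>_def isCont_def case_prod_unfold by (auto intro!: tendsto_eq_intros)
  qed (simp add: \<phi>_def mult.commute)
  hence "continuous_on ordered_domain \<kappa>"
    unfolding \<kappa>_def \<phi>_def by (auto intro!: continuous_intros continuous_on_sqrt_v simp: sqrt_v_nonzero)
  moreover have sq: "(\<kappa> Y)\<^sup>2 = 1" if "Y \<in> ordered_domain" for Y
    using is_z_zbar_z_plus_minus[of Y] sqrt_v_squared[OF that] sqrt_v_nonzero[of Y]
    by (auto simp: \<kappa>_def power_divide power_mult_distrib is_z_zbar_def)
  have range: "\<kappa> Y = 1 \<or> \<kappa> Y = -1" if "Y \<in> ordered_domain" for Y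
    using sq[OF that] by (simp add: power2_eq_1_iff)
  have "\<kappa> constant_on ordered_domain"
  proof (rule continuous_discrete_range_constant[OF connected_ordered_domain])
    fix Y :: "'a cconfig" assume Y: "Y \<in> ordered_domain"
    show "\<exists>e>0. \<forall>Z. Z \<in> ordered_domain \<and> \<kappa> Z \<noteq> \<kappa> Y \<longrightarrow> e \<le> norm (\<kappa> Z - \<kappa> Y)"
      using range[OF Y] range by (intro exI[of _ 1]) fastforce
  qed fact
  then obtain k where k: "\<And>Y. Y \<in> ordered_domain \<Longrightarrow> \<kappa> Y = k"
    unfolding constant_on_def by blast
  \<comment> \<open>Any real configuration in the domain would do; this one has times 3, 2, 1, 0 and
    all spatial coordinates zero.\<close>
  define B :: "'a econfig" where "B = (\<chi> k. (if k = 1 then 3 else if k = 2 then 2 else if k = 3 then 1 else 0, 0))"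
  have B: "complexify B \<in> ordered_domain"
    by (simp add: B_def complexify_def ordered_domain_def)
  obtain r s where "r > 0" "s > 0" "\<kappa> (complexify B) = of_real r / of_real s"
    using complexify_roots_pos(1)[OF B is_z_zbar_z_plus_minus] complexify_sqrt_v_pos[OF B]
    unfolding \<kappa>_def by metis
  hence "Re (\<kappa> (complexify B)) > 0" by (simp flip: of_real_divide)
  hence "\<kappa> (complexify B) = 1" using range[OF B] by auto
  hence "\<kappa> X = 1" using k X B by simp
  thus ?thesis unfolding \<kappa>_def using sqrt_v_nonzero[of X] by (simp add: divide_eq_1_iff)
qed

text \<open>Here \<open>u = (1 - a^2) (1 - b^2)\<close> and \<open>v = a^2 b^2\<close>, so
  \<open>1 - u + v\<close> is \<open>a^2 + b^2\<close>. Both \<open>a\<close> and \<open>b\<close>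
  lie in the right half-plane, hence \<open>a + b\<close> is the principal root and
  \<open>(1 + a) (1 + b)\<close> avoids the cut of the logarithm.\<close>

lemma csqrt_arg_eq:
  assumes X: "X \<in> ordered_domain"
  defines "a \<equiv> csqrt (1 - z_plus X)" and "b \<equiv> csqrt (1 - z_minus X)"
  shows "1 - cross_u X + cross_v X + 2 * sqrt_v X = (a + b)\<^sup>2"
    and "Re a > 0" and "Re b > 0"
    and "1 - cross_u X + cross_v X + 2 * sqrt_v X \<notin> \<real>\<^sub>\<le>\<^sub>0"
    and "csqrt (1 - cross_u X + cross_v X + 2 * sqrt_v X) = a + b"
    and "rho_denom X = (1 + a) * (1 + b)" and "rho_denom X \<notin> \<real>\<^sub>\<le>\<^sub>0"
proof -
  have ab: "a\<^sup>2 = 1 - z_plus X" "b\<^sup>2 = 1 - z_minus X" by (simp_all add: a_def b_def)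
  have "cross_u X = (1 - a\<^sup>2) * (1 - b\<^sup>2)" "cross_v X = a\<^sup>2 * b\<^sup>2"
    using is_z_zbar_z_plus_minus[of X] by (simp_all add: is_z_zbar_def ab)
  thus eq: "1 - cross_u X + cross_v X + 2 * sqrt_v X = (a + b)\<^sup>2"
    unfolding sqrt_v_eq[OF X] a_def[symmetric] b_def[symmetric]
    by (simp add: power2_eq_square algebra_simps)
  show pos: "Re a > 0" "Re b > 0"
    unfolding a_def b_def
    using z_plus_notin_branch_cut[OF X] z_minus_notin_branch_cut[OF X] branch_cut_iff Re_csqrt_pos by blast+
  show "1 - cross_u X + cross_v X + 2 * sqrt_v X \<notin> \<real>\<^sub>\<le>\<^sub>0"
    unfolding eq power2_eq_square using pos by (intro mult_notin_nonpos_Reals) simp_all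
  show cs: "csqrt (1 - cross_u X + cross_v X + 2 * sqrt_v X) = a + b"
    unfolding eq using pos by (intro csqrt_square) simp
  show W: "rho_denom X = (1 + a) * (1 + b)"
    unfolding rho_denom_def cs unfolding sqrt_v_eq[OF X] a_def[symmetric] b_def[symmetric]
    by (simp add: algebra_simps)
  show "rho_denom X \<notin> \<real>\<^sub>\<le>\<^sub>0"
    unfolding W using pos by (intro mult_notin_nonpos_Reals) simp_all
qed

lemma rho_sum_eq:
  assumes X: "X \<in> ordered_domain"
  shows "rho_sum X = rho (z_plus X) + rho (z_minus X)"
proof -
  define a b where "a = csqrt (1 - z_plus X)" and "b = csqrt (1 - z_minus X)"
  note ab = csqrt_arg_eq[OF X, folded a_def b_def]
  have nz: "1 + a \<noteq> 0" "1 + b \<noteq> 0" using ab one_plus_nonzero by blast+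
  have "rho (z_plus X) + rho (z_minus X) = (1 - a) / (1 + a) + (1 - b) / (1 + b)"
    unfolding rho_eq[OF z_plus_notin_branch_cut[OF X]] rho_eq[OF z_minus_notin_branch_cut[OF X]]
    by (simp add: a_def b_def)
  also have "\<dots> = ((1 - a) * (1 + b) + (1 - b) * (1 + a)) / ((1 + a) * (1 + b))"
    using nz by (rule add_frac_eq)
  also have "(1 - a) * (1 + b) + (1 - b) * (1 + a) = 2 * (1 - a * b)"
    by (simp add: algebra_simps)
  finally show ?thesis
    unfolding rho_sum_def ab(6) sqrt_v_eq[OF X] a_def b_def by simp
qed

lemma exp_log_rho_prod:
  assumes X: "X \<in> ordered_domain"
  shows "exp (log_rho_prod X) = rho (z_plus X) * rho (z_minus X)"
proof -
  define a b where "a = csqrt (1 - z_plus X)" and "b = csqrt (1 - z_minus X)"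
  note ab = csqrt_arg_eq[OF X, folded a_def b_def]
  have nz: "1 + a \<noteq> 0" "1 + b \<noteq> 0" using ab one_plus_nonzero by blast+
  have W: "rho_denom X \<noteq> 0" using ab(7) by auto
  have "z_plus X = 1 - a\<^sup>2" "z_minus X = 1 - b\<^sup>2" by (simp_all add: a_def b_def)
  hence "cross_u X = (1 - a\<^sup>2) * (1 - b\<^sup>2)"
    using is_z_zbar_z_plus_minus[of X] by (simp add: is_z_zbar_def)
  hence u: "cross_u X = (1 - a) * (1 - b) * rho_denom X"
    unfolding ab(6) by (simp add: power2_eq_square algebra_simps)
  have "exp (log_rho_prod X) = cross_u X / (rho_denom X)\<^sup>2"
    using xsq_ordered_domain_nonzero[OF X] W
    by (simp add: log_rho_prod_def exp_diff exp_add cross_u_def exp_double)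
  also have "\<dots> = (1 - a) * (1 - b) / ((1 + a) * (1 + b))"
    unfolding u using W by (simp add: power2_eq_square flip: ab(6))
  also have "\<dots> = rho (z_plus X) * rho (z_minus X)"
    unfolding rho_eq[OF z_plus_notin_branch_cut[OF X]] rho_eq[OF z_minus_notin_branch_cut[OF X]]
    by (simp add: a_def b_def)
  finally show ?thesis .
qed

lemma rho_nonzero:
  assumes "X \<in> ordered_domain"
  shows "rho (z_plus X) \<noteq> 0" "rho (z_minus X) \<noteq> 0"
  using exp_log_rho_prod[OF assms] by (metis exp_not_eq_zero mult_zero_left mult_zero_right)+

text \<open>Reality singles out the principal logarithm, so at real configurations exponentials of
  \<open>log_rho_prod\<close> agree with the principal powers in the given expansion.\<close>

lemma log_rho_prod_complexify:
  assumes X: "complexify Y \<in> ordered_domain"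
  shows "log_rho_prod (complexify Y) \<in> \<real>"
proof -
  let ?X = "complexify Y"
  note ab = csqrt_arg_eq[OF X]
  obtain r s where "r > 0" "s > 0" "sqrt_v ?X = of_real r"
     "csqrt (1 - z_plus ?X) + csqrt (1 - z_minus ?X) = of_real s"
    using complexify_roots_pos(2)[OF X is_z_zbar_z_plus_minus] complexify_sqrt_v_pos[OF X] by metis
  hence "rho_denom ?X = of_real (1 + s + r)" "1 + s + r > 0"
    unfolding rho_denom_def ab(5) by simp_all
  hence "Ln (rho_denom ?X) \<in> \<real>" by (simp add: Ln_of_real del: of_real_add)
  moreover have "Ln (xsq ?X 1 2) \<in> \<real>" "Ln (xsq ?X 3 4) \<in> \<real>" "Ln (xsq ?X 1 3) \<in> \<real>" "Ln (xsq ?X 2 4) \<in> \<real>"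
    using xsq_complexify[OF X] by (auto simp: Ln_of_real)
  ultimately show ?thesis unfolding log_rho_prod_def by simp
qed

section \<open>The symmetrized series\<close>

text \<open>Newton's recurrence for \<open>x ^ n + y ^ n\<close> as a polynomial in
  \<open>e1 = x + y\<close> and \<open>e2 = x * y\<close>.\<close>

fun power_sum :: "complex \<Rightarrow> complex \<Rightarrow> nat \<Rightarrow> complex" where
  "power_sum e1 e2 0 = 2"
| "power_sum e1 e2 (Suc 0) = e1"
| "power_sum e1 e2 (Suc (Suc n)) = e1 * power_sum e1 e2 (Suc n) - e2 * power_sum e1 e2 n"

lemma power_sum_eq: "power_sum (x + y) (x * y) n = x ^ n + y ^ n"
  by (induction n rule: induct_nat_012) (simp_all add: algebra_simps)

text \<open>
  On the domain this is \<open>B h hb / 2\<close> times the sum of \<open>\<rho> ^ h * \<rho>b ^ hb\<close> and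
  \<open>\<rho> ^ hb * \<rho>b ^ h\<close>, written through the elementary symmetric functions of \<open>\<rho>\<close> and \<open>\<rho>b\<close>,
  which are analytic where \<open>\<rho>\<close> and \<open>\<rho>b\<close> themselves are not.
\<close>

definition symmetrized_term :: "(real \<Rightarrow> real \<Rightarrow> real) \<Rightarrow> real \<times> real \<Rightarrow> 'n::finite cconfig \<Rightarrow> complex" where
  "symmetrized_term B = (\<lambda>(h, hb) X. of_real (B h hb / 2) * exp (of_real (min h hb) * log_rho_prod X)
     * power_sum (rho_sum X) (exp (log_rho_prod X)) (nat \<lfloor>\<bar>h - hb\<bar>\<rfloor>))"

lemma weights_cases:
  assumes "(h, hb) \<in> weights"
  obtains n where "h = hb + real n" | n where "hb = h + real n"
proof -
  from assms obtain i :: int where i: "h - hb = of_int i" by (auto simp: weights_def Ints_def)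
  show thesis
  proof (cases "i \<ge> 0")
    case True
    thus thesis using i that(1)[of "nat i"] by simp
  next
    case False
    thus thesis using i that(2)[of "nat (- i)"] by simp
  qed
qed

text \<open>Exchanging the exponents \<open>h = hb + n\<close> and \<open>hb\<close> trades
  \<open>r ^ n\<close> for \<open>rb ^ n\<close>, because \<open>(r * rb) ^ n\<close> times
  \<open>r\<close> to the power \<open>- n\<close> is \<open>rb ^ n\<close>. Only a logarithm of the
  product enters.\<close>

lemma symmetrized_pair:
  assumes L: "exp L = r * rb" and r: "r \<noteq> (0::complex)"
  shows "exp (of_real hb * L) * r powi int n + exp (of_real (hb + real n) * L) * r powi (- int n)
    = exp (of_real hb * L) * (r ^ n + rb ^ n)"
proof -
  have "exp (of_real (hb + real n) * L) = exp (of_real hb * L) * (r * rb) ^ n"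
    by (simp add: distrib_right exp_add exp_of_nat_mult L)
  thus ?thesis using r
    by (simp add: power_int_minus power_mult_distrib distrib_left)
qed

text \<open>The two summands have the shape of \<open>rho_monom\<close> for \<open>(h, hb)\<close>
  and \<open>(hb, h)\<close>, which allows comparison with \<open>expansion_b\<close> at real
  configurations.\<close>

lemma symmetrized_term_eq:
  assumes X: "X \<in> ordered_domain" and w: "(h, hb) \<in> weights"
  shows "symmetrized_term B (h, hb) X = of_real (B h hb / 2) *
    (exp (of_real hb * log_rho_prod X) * rho (z_plus X) powi \<lfloor>h - hb\<rfloor>
     + exp (of_real h * log_rho_prod X) * rho (z_plus X) powi \<lfloor>hb - h\<rfloor>)"
  using w
proof (cases rule: weights_cases)
  case (1 n)
  have fl: "\<lfloor>h - hb\<rfloor> = int n" "\<lfloor>hb - h\<rfloor> = - int n" using 1 by linarith+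
  have "symmetrized_term B (h, hb) X = of_real (B h hb / 2) *
      (exp (of_real hb * log_rho_prod X) * (rho (z_plus X) ^ n + rho (z_minus X) ^ n))"
    by (simp add: symmetrized_term_def rho_sum_eq[OF X] exp_log_rho_prod[OF X] power_sum_eq 1)
  also note symmetrized_pair[OF exp_log_rho_prod[OF X] rho_nonzero(1)[OF X], of hb n, symmetric]
  finally show ?thesis unfolding fl unfolding 1 .
next
  case (2 n)
  have fl: "\<lfloor>h - hb\<rfloor> = - int n" "\<lfloor>hb - h\<rfloor> = int n" using 2 by linarith+
  have "symmetrized_term B (h, hb) X = of_real (B h hb / 2) *
      (exp (of_real h * log_rho_prod X) * (rho (z_plus X) ^ n + rho (z_minus X) ^ n))"
    by (simp add: symmetrized_term_def rho_sum_eq[OF X] exp_log_rho_prod[OF X] power_sum_eq 2)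
  also note symmetrized_pair[OF exp_log_rho_prod[OF X] rho_nonzero(1)[OF X], of h n, symmetric]
  finally show ?thesis unfolding fl unfolding 2 by (simp only: add.commute)
qed

text \<open>With \<open>m\<close> the smaller exponent and \<open>n\<close> the gap, the product
  contributes at most \<open>R ^ (2 m)\<close> and the power sum at most \<open>2 R ^ n\<close>. The
  factor 2 cancels the half, and \<open>2 m + n = h + hb\<close>. This is the majorant for the
  Weierstrass test.\<close>

lemma norm_symmetrized_term_le:
  assumes X: "X \<in> ordered_domain" and w: "(h, hb) \<in> weights" and B: "B h hb \<ge> 0"
    and R: "0 < R" "cmod (rho (z_plus X)) \<le> R" "cmod (rho (z_minus X)) \<le> R"
  shows "cmod (symmetrized_term B (h, hb) X) \<le> B h hb * R powr h * R powr hb"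
proof -
  define m n where "m = min h hb" and "n = nat \<lfloor>\<bar>h - hb\<bar>\<rfloor>"
  have m: "m \<ge> 0" using w by (auto simp: m_def weights_def)
  have n: "h + hb = m + m + real n"
    using w by (cases rule: weights_cases) (auto simp: m_def n_def)
  let ?r = "rho (z_plus X)" and ?rb = "rho (z_minus X)"
  have "exp (Re (log_rho_prod X)) = cmod ?r * cmod ?rb"
    by (metis norm_exp_eq_Re exp_log_rho_prod[OF X] norm_mult)
  also have "\<dots> \<le> R * R" using R by (intro mult_mono) auto
  finally have "exp (Re (log_rho_prod X)) powr m \<le> (R * R) powr m"
    using m by (intro powr_mono2) auto
  hence e: "cmod (exp (of_real m * log_rho_prod X)) \<le> R powr m * R powr m"
    using R by (simp add: powr_mult exp_powr_real mult.commute)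
  have "cmod (?r ^ n + ?rb ^ n) \<le> cmod ?r ^ n + cmod ?rb ^ n"
    by (metis norm_power norm_triangle_ineq)
  also have "\<dots> \<le> R ^ n + R ^ n" using R by (intro add_mono power_mono) auto
  finally have p: "cmod (?r ^ n + ?rb ^ n) \<le> 2 * R powr real n"
    using R by (simp add: powr_realpow)
  have "cmod (symmetrized_term B (h, hb) X)
      = B h hb / 2 * cmod (exp (of_real m * log_rho_prod X)) * cmod (?r ^ n + ?rb ^ n)"
    using B by (simp add: symmetrized_term_def rho_sum_eq[OF X] exp_log_rho_prod[OF X] power_sum_eq
        norm_mult m_def n_def)
  also have "\<dots> \<le> B h hb / 2 * (R powr m * R powr m) * (2 * R powr real n)"
    using B R by (intro mult_mono e p mult_left_mono) auto
  also have "\<dots> = B h hb * R powr (h + hb)"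
    unfolding n powr_add by simp
  finally show ?thesis by (simp add: powr_add)
qed

lemma open_ordered_domain: "open (ordered_domain :: 'n::finite cconfig set)"
  unfolding ordered_domain_def by (intro open_Collect_conj open_Collect_less continuous_intros)

text \<open>The maximum of the two moduli is symmetric, so it is continuous even where the labelling
  of the roots jumps.\<close>

lemma rho_locally_bounded:
  fixes X0 :: "'n::finite cconfig"
  assumes X0: "X0 \<in> ordered_domain"
  obtains e R where "0 < e" "0 < R" "R < 1" "ball X0 e \<subseteq> ordered_domain"
    "\<And>X. X \<in> ball X0 e \<Longrightarrow> cmod (rho (z_plus X)) \<le> R \<and> cmod (rho (z_minus X)) \<le> R"
proof -
  define \<phi> where "\<phi> = (\<lambda>(a, b). max (cmod (rho a)) (cmod (rho b)))"
  have cont: "continuous_on ordered_domain (\<lambda>X :: 'n cconfig. \<phi> (z_plus X, z_minus X))"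
  proof (rule continuous_on_symmetric_roots)
    fix a b assume ab: "a \<notin> branch_cut" "b \<notin> branch_cut"
    have "((\<lambda>x. rho (fst x)) \<longlongrightarrow> rho a) (at (a, b))"
      "((\<lambda>x. rho (snd x)) \<longlongrightarrow> rho b) (at (a, b))"
      using isCont_tendsto_compose[OF isCont_rho[OF ab(1)], of fst "at (a, b)"]
        isCont_tendsto_compose[OF isCont_rho[OF ab(2)], of snd "at (a, b)"]
        tendsto_fst[OF tendsto_ident_at, of "(a, b)"] tendsto_snd[OF tendsto_ident_at, of "(a, b)"] by simp_all
    thus "isCont \<phi> (a, b)"
      unfolding \<phi>_def isCont_def case_prod_unfold by (auto intro!: tendsto_intros)
  qed (simp add: \<phi>_def max.commute)
  have "\<phi> (z_plus X0, z_minus X0) < 1"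
    using norm_rho_less_1 z_plus_notin_branch_cut[OF X0] z_minus_notin_branch_cut[OF X0] by (simp add: \<phi>_def)
  then obtain R where R: "\<phi> (z_plus X0, z_minus X0) < R" "R < 1" using dense by blast
  have "0 \<le> \<phi> (z_plus X0, z_minus X0)" by (simp add: \<phi>_def le_max_iff_disj)
  hence "0 < R" using R by linarith
  have "isCont (\<lambda>X. \<phi> (z_plus X, z_minus X)) X0"
    using cont X0 open_ordered_domain continuous_on_eq_continuous_at by blast
  hence "\<forall>\<^sub>F X in at X0. \<phi> (z_plus X, z_minus X) < R"
    using R(1) unfolding isCont_def by (rule order_tendstoD)
  then obtain e1 where e1: "e1 > 0" "\<And>X. X \<noteq> X0 \<Longrightarrow> dist X X0 < e1 \<Longrightarrow> \<phi> (z_plus X, z_minus X) < R"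
    unfolding eventually_at by auto
  obtain e2 where e2: "e2 > 0" "ball X0 e2 \<subseteq> ordered_domain"
    using open_ordered_domain X0 open_contains_ball by blast
  show thesis
  proof (rule that[of "min e1 e2" R])
    fix X assume "X \<in> ball X0 (min e1 e2)"
    hence "\<phi> (z_plus X, z_minus X) < R"
      using e1(2)[of X] R(1) by (cases "X = X0") (auto simp: dist_commute)
    thus "cmod (rho (z_plus X)) \<le> R \<and> cmod (rho (z_minus X)) \<le> R"
      by (simp add: \<phi>_def)
  qed (use e1 e2 \<open>0 < R\<close> R in auto)
qed

section \<open>Regularity of the individual terms\<close>

lemma continuous_on_rho_denom: "continuous_on ordered_domain rho_denom"
  unfolding rho_denom_def
  by (intro continuous_intros continuous_on_cross continuous_on_sqrt_v
      continuous_on_compose2[OF continuous_on_csqrt])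
     (auto simp: csqrt_arg_eq(4))

lemma continuous_on_log_rho_prod: "continuous_on ordered_domain log_rho_prod"
  unfolding log_rho_prod_def
  by (intro continuous_intros continuous_on_xsq continuous_on_rho_denom)
     (simp_all add: xsq_ordered_domain csqrt_arg_eq(7))

lemma continuous_on_rho_sum: "continuous_on ordered_domain rho_sum"
  unfolding rho_sum_def
  by (intro continuous_intros continuous_on_sqrt_v continuous_on_rho_denom ballI)
     (metis csqrt_arg_eq(7) nonpos_Reals_zero_I)

lemma continuous_on_power_sum:
  assumes "continuous_on S f" "continuous_on S g"
  shows "continuous_on S (\<lambda>x. power_sum (f x) (g x) n)"
  by (induction n rule: induct_nat_012) (auto intro!: continuous_intros assms)

lemma continuous_on_symmetrized_term: "continuous_on ordered_domain (symmetrized_term B i)"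
  unfolding symmetrized_term_def case_prod_unfold
  by (intro continuous_intros continuous_on_power_sum continuous_on_log_rho_prod continuous_on_rho_sum)

lemma complex_differentiable_at_power_sum:
  assumes "complex_differentiable_at f t" "complex_differentiable_at g t"
  shows "complex_differentiable_at (\<lambda>t. power_sum (f t) (g t) n) t"
  by (induction n rule: induct_nat_012) (auto intro!: complex_differentiable_at_intros assms)

lemma complex_differentiable_at_xsq: "complex_differentiable_at (\<lambda>t. xsq (config t x) i j) t"
  unfolding xsq_def config_def power2_eq_square
  by (simp, intro complex_differentiable_at_intros)

lemma complex_differentiable_at_config:
  assumes t: "config t x \<in> ordered_domain"
  shows "complex_differentiable_at (\<lambda>t. symmetrized_term B i (config t x)) t"
proof -
  note nz = xsq_ordered_domain_nonzero[OF t] and np = xsq_ordered_domain[OF t]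
  have u: "complex_differentiable_at (\<lambda>t. cross_u (config t x)) t"
    and v: "complex_differentiable_at (\<lambda>t. cross_v (config t x)) t"
    unfolding cross_u_def cross_v_def
    by (intro complex_differentiable_at_intros complex_differentiable_at_xsq; simp add: nz)+
  have s: "complex_differentiable_at (\<lambda>t. sqrt_v (config t x)) t"
    unfolding sqrt_v_def
    by (intro complex_differentiable_at_intros complex_differentiable_at_xsq np) simp
  have d: "complex_differentiable_at (\<lambda>t. rho_denom (config t x)) t"
    unfolding rho_denom_def
    by (intro complex_differentiable_at_intros u v s csqrt_arg_eq(4) t)
  have l: "complex_differentiable_at (\<lambda>t. log_rho_prod (config t x)) t"
    unfolding log_rho_prod_def
    by (intro complex_differentiable_at_intros complex_differentiable_at_xsq np d csqrt_arg_eq(7) t)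
  have "rho_denom (config t x) \<noteq> 0"
    using csqrt_arg_eq(7)[OF t] by auto
  hence r: "complex_differentiable_at (\<lambda>t. rho_sum (config t x)) t"
    unfolding rho_sum_def by (intro complex_differentiable_at_intros s d)
  show ?thesis
    unfolding symmetrized_term_def case_prod_unfold
    by (intro complex_differentiable_at_intros complex_differentiable_at_power_sum l r)
qed

lemma continuous_on_config: "continuous_on UNIV (\<lambda>t. config t x)"
  unfolding config_def by (intro continuous_intros)

section \<open>Locally uniform convergence of the symmetrized series\<close>

context
  fixes B :: "real \<Rightarrow> real \<Rightarrow> real"
  assumes B_nonneg: "\<And>h hb. (h, hb) \<in> weights \<Longrightarrow> 0 \<le> B h hb"
    and B_summable: "\<And>R. 0 < R \<Longrightarrow> R < 1 \<Longrightarrow> (\<lambda>(h, hb). B h hb * R powr h * R powr hb) summable_on weights"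
begin

text \<open>Uniformity holds on a ball of whole configurations, times and positions together, so it
  serves both continuity and analyticity of the sum.\<close>

lemma symmetrized_series_uniform_limit:
  assumes X0: "X0 \<in> ordered_domain"
  obtains e where "0 < e" "ball X0 e \<subseteq> ordered_domain"
    "uniform_limit (ball X0 e) (\<lambda>I X. \<Sum>i\<in>I. symmetrized_term B i X)
       (\<lambda>X. \<Sum>\<^sub>\<infinity>i\<in>weights. symmetrized_term B i X) (finite_subsets_at_top weights)"
proof -
  obtain e R where e: "0 < e" and R: "0 < R" "R < 1" and sub: "ball X0 e \<subseteq> ordered_domain"
    and le: "\<And>X. X \<in> ball X0 e \<Longrightarrow> cmod (rho (z_plus X)) \<le> R \<and> cmod (rho (z_minus X)) \<le> R"
    using rho_locally_bounded[OF X0] by metis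
  have "uniform_limit (ball X0 e) (\<lambda>I X. \<Sum>i\<in>I. symmetrized_term B i X)
       (\<lambda>X. \<Sum>\<^sub>\<infinity>i\<in>weights. symmetrized_term B i X) (finite_subsets_at_top weights)"
  proof (rule Weierstrass_m_test_general[OF _ B_summable[OF R]])
    fix i :: "real \<times> real" and X assume i: "i \<in> weights" and X: "X \<in> ball X0 e"
    obtain h hb where [simp]: "i = (h, hb)" by (cases i)
    show "norm (symmetrized_term B i X) \<le> (case i of (h, hb) \<Rightarrow> B h hb * R powr h * R powr hb)"
      using norm_symmetrized_term_le[of X h hb B R] X i sub le B_nonneg R by auto
  qed
  thus thesis using e sub that by blast
qed

lemma continuous_on_symmetrized_series:
  "continuous_on ordered_domain (\<lambda>X. \<Sum>\<^sub>\<infinity>i\<in>weights. symmetrized_term B i X)"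
proof (rule continuous_at_imp_continuous_on, rule ballI)
  fix X0 :: "'n::finite cconfig" assume "X0 \<in> ordered_domain"
  then obtain e where e: "0 < e" "ball X0 e \<subseteq> ordered_domain"
    "uniform_limit (ball X0 e) (\<lambda>I X. \<Sum>i\<in>I. symmetrized_term B i X)
       (\<lambda>X. \<Sum>\<^sub>\<infinity>i\<in>weights. symmetrized_term B i X) (finite_subsets_at_top weights)"
    by (rule symmetrized_series_uniform_limit)
  have "continuous_on (ball X0 e) (\<lambda>X. \<Sum>\<^sub>\<infinity>i\<in>weights. symmetrized_term B i X)"
    by (rule uniform_limit_theorem[OF _ e(3)])
       (auto intro!: always_eventually continuous_intros continuous_on_subset[OF continuous_on_symmetrized_term e(2)])
  thus "isCont (\<lambda>X. \<Sum>\<^sub>\<infinity>i\<in>weights. symmetrized_term B i X) X0"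
    using e(1) by (simp add: continuous_on_eq_continuous_at)
qed

lemma complex_differentiable_at_symmetrized_series:
  assumes t0: "config t0 x \<in> ordered_domain"
  shows "complex_differentiable_at (\<lambda>t. \<Sum>\<^sub>\<infinity>i\<in>weights. symmetrized_term B i (config t x)) t0"
proof -
  obtain e where e: "0 < e" "ball (config t0 x) e \<subseteq> ordered_domain"
    "uniform_limit (ball (config t0 x) e) (\<lambda>I X. \<Sum>i\<in>I. symmetrized_term B i X)
       (\<lambda>X. \<Sum>\<^sub>\<infinity>i\<in>weights. symmetrized_term B i X) (finite_subsets_at_top weights)"
    using symmetrized_series_uniform_limit[OF t0] by blast
  have "open ((\<lambda>t. config t x) -` ball (config t0 x) e)"
    using continuous_on_config by (intro continuous_open_vimage) (auto simp: continuous_on_eq_continuous_within)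
  moreover have "t0 \<in> (\<lambda>t. config t x) -` ball (config t0 x) e" using e by simp
  ultimately obtain e' where e': "e' > 0" "ball t0 e' \<subseteq> (\<lambda>t. config t x) -` ball (config t0 x) e"
    using open_contains_ball by blast
  hence "(\<lambda>t. config t x) \<in> ball t0 e' \<rightarrow> ball (config t0 x) e" by auto
  note ul = uniform_limit_compose'[OF e(3) this]
  show ?thesis
  proof (rule complex_differentiable_at_uniform_limit[OF e'(1) _ ul])
    have "config t x \<in> ordered_domain" if "t \<in> ball t0 e'" for t using that e' e by blast
    thus "\<forall>\<^sub>F I in finite_subsets_at_top weights. \<forall>t\<in>ball t0 e'.
        complex_differentiable_at (\<lambda>t. \<Sum>i\<in>I. symmetrized_term B i (config t x)) t"
      by (intro always_eventually allI ballI complex_differentiable_at_sum complex_differentiable_at_config)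
  qed simp
qed

end

section \<open>Agreement with the Euclidean function\<close>

text \<open>The reflection \<open>k\<close> to \<open>l - k\<close> changes the sign of
  \<open>l - 2 k\<close> and keeps \<open>h + hb\<close>.\<close>

lemma bcoeff_sym:
  assumes "\<And>l k. k \<le> l \<Longrightarrow> p l k = p l (l - k)"
  shows "bcoeff c p h hb = bcoeff c p hb h"
proof -
  let ?A = "\<lambda>h hb. {(l, k). k \<le> l \<and> real l - 2 * real k = h - hb}"
  have bij: "bij_betw (\<lambda>(l, k). (l, l - k)) (?A h hb) (?A hb h)"
    by (rule bij_betwI[where g = "\<lambda>(l, k). (l, l - k)"]) (auto simp: of_nat_diff)
  have "bcoeff c p hb h = (\<Sum>\<^sub>\<infinity>x\<in>?A h hb. case (case x of (l, k) \<Rightarrow> (l, l - k)) of (l, k) \<Rightarrow> c (hb + h) l * p l k)"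
    unfolding bcoeff_def by (rule infsum_reindex_bij_betw[OF bij, symmetric])
  also have "\<dots> = bcoeff c p h hb"
    unfolding bcoeff_def
  proof (rule infsum_cong)
    fix x assume "x \<in> ?A h hb"
    then obtain l k where "x = (l, k)" "k \<le> l" by auto
    thus "(case (case x of (l, k) \<Rightarrow> (l, l - k)) of (l, k) \<Rightarrow> c (hb + h) l * p l k)
        = (case x of (l, k) \<Rightarrow> c (h + hb) l * p l k)"
      using assms[of k l] by (simp add: add.commute)
  qed
  finally show ?thesis by simp
qed

lemma inj_config:
  assumes "complexify X \<in> ordered_domain"
  shows "inj (($) X)"
proof (rule injI)
  have o: "fst (X $ 1) > fst (X $ 2)" "fst (X $ 2) > fst (X $ 3)" "fst (X $ 3) > fst (X $ 4)"
    using assms by (simp_all add: ordered_domain_def complexify_def)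
  fix i j assume "X $ i = X $ j"
  hence "fst (X $ i) = fst (X $ j)" by simp
  thus "i = j" using o exhaust_4[of i] exhaust_4[of j] by auto
qed

theorem mainTheorem1:
  fixes d :: nat and \<Delta> :: real
    and GE :: "'n::finite econfig \<Rightarrow> complex"
    and g :: "complex \<Rightarrow> complex \<Rightarrow> complex"
    and c :: "real \<Rightarrow> nat \<Rightarrow> real"
    and p :: "nat \<Rightarrow> nat \<Rightarrow> real"
    and nrm :: "nat \<Rightarrow> real"
  assumes "d \<ge> 2" and "CARD('n) = d - 1"
    and "euclidean_four_point d \<Delta> GE g c p nrm"
  shows "\<exists>G :: 'n cconfig \<Rightarrow> complex.
           (\<forall>x. analytic_several_on (\<lambda>t. G (config t x)) {t. config t x \<in> ordered_domain}) \<and>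
           continuous_on ordered_domain G \<and>
           (\<forall>X. complexify X \<in> ordered_domain \<longrightarrow> G (complexify X) = GE X)"
proof -
  interpret euclidean_four_point d \<Delta> GE g c p nrm by fact
  define b where "b = bcoeff c p"
  have b_nn: "\<And>h hb. (h, hb) \<in> weights \<Longrightarrow> 0 \<le> b h hb"
    unfolding b_def by (rule b_nonneg)
  have b_sum: "(\<lambda>(h, hb). b h hb * R powr h * R powr hb) summable_on weights" if "0 < R" "R < 1" for R
    using absolutely_convergent[of "of_real R" "of_real R"] that by (simp add: b_def)
  define S where "S X = (\<Sum>\<^sub>\<infinity>i\<in>weights. symmetrized_term b i X)" for X :: "'n cconfig"
  \<comment> \<open>The exponentials are the principal powers with exponent \<open>\<Delta>\<close>,
    since the bases are nonzero; in this form the rules for \<open>Ln\<close> and \<open>exp\<close>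
    apply.\<close>
  define G where "G X = S X / (exp (of_real \<Delta> * Ln (xsq X 1 2)) * exp (of_real \<Delta> * Ln (xsq X 3 4)))" for X
  show ?thesis
  proof (intro exI[of _ G] conjI allI impI)
    fix x :: "(real ^ 'n) ^ 4"
    have "open ((\<lambda>t. config t x) -` ordered_domain)"
      using continuous_on_config by (intro continuous_open_vimage open_ordered_domain) (auto simp: continuous_on_eq_continuous_within)
    hence op: "open {t. config t x \<in> ordered_domain}" by (simp add: vimage_def)
    have cd: "complex_differentiable_at (\<lambda>t. G (config t x)) t" if "config t x \<in> ordered_domain" for t
      unfolding G_def S_def
      by (intro complex_differentiable_at_intros complex_differentiable_at_xsq xsq_ordered_domain[OF that]
          complex_differentiable_at_symmetrized_series b_nn b_sum that) simp_all
    show "analytic_several_on (\<lambda>t. G (config t x)) {t. config t x \<in> ordered_domain}"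
      unfolding analytic_several_on_def
    proof
      fix t assume "t \<in> {t. config t x \<in> ordered_domain}"
      then obtain e where "e > 0" "ball t e \<subseteq> {t. config t x \<in> ordered_domain}"
        using op open_contains_ball by blast
      thus "\<exists>e>0. \<forall>w\<in>ball t e. \<exists>a. ((\<lambda>t. G (config t x)) has_derivative (\<lambda>y. \<Sum>k\<in>UNIV. a $ k * y $ k)) (at w)"
        using cd unfolding complex_differentiable_at_def by blast
    qed
  next
    show "continuous_on ordered_domain G"
      unfolding G_def S_def
      by (intro continuous_intros continuous_on_symmetrized_series b_nn b_sum continuous_on_xsq)
         (auto simp: xsq_ordered_domain)
  next
    fix Y :: "'n econfig" assume Y: "complexify Y \<in> ordered_domain"
    define X where "X = complexify Y"
    have X: "X \<in> ordered_domain" using Y by (simp add: X_def)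
    define r rb where "r = rho (z_plus X)" and "rb = rho (z_minus X)"
    let ?L = "log_rho_prod X"
    let ?a = "\<lambda>(h, hb). of_real (b h hb) * (exp (of_real hb * ?L) * r powi \<lfloor>h - hb\<rfloor>)"
    have "Im ?L = 0"
      using log_rho_prod_complexify[OF Y] by (simp add: X_def complex_is_Real_iff)
    \<comment> \<open>A real number lies in the strip on which \<open>Ln\<close> inverts
      \<open>exp\<close>, so the principal power in \<open>rho_monom\<close> is computed from
      \<open>log_rho_prod\<close>.\<close>
    hence "Ln (r * rb) = ?L"
      unfolding r_def rb_def exp_log_rho_prod[OF X, symmetric] by (intro Ln_exp) (auto simp: pi_gt_zero)
    hence monom: "rho_monom h hb r rb = exp (of_real hb * ?L) * r powi \<lfloor>h - hb\<rfloor>" for h hb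
      using rho_nonzero[OF X] by (simp add: rho_monom_def powr_def r_def rb_def)
    have 1: "(?a has_sum g (cross_u X) (cross_v X)) weights"
      unfolding monom[symmetric] unfolding b_def r_def rb_def X_def
      by (rule expansion_b[OF inj_config[OF Y] is_z_zbar_z_plus_minus z_plus_notin_branch_cut[OF Y]])
    have "bij_betw prod.swap weights weights"
      by (rule bij_betwI[where g = prod.swap])
         (auto simp: weights_def, (metis Ints_minus minus_diff_eq)+)
    with 1 have 2: "((\<lambda>i. ?a (prod.swap i)) has_sum g (cross_u X) (cross_v X)) weights"
      by (subst has_sum_reindex_bij_betw)
    \<comment> \<open>The expansion is averaged with its copy under exchange of \<open>h\<close> and
      \<open>hb\<close>; by symmetry of the coefficients each averaged term is a symmetrized
      one.\<close>
    have 3: "((\<lambda>i. 1 / 2 * (?a i + ?a (prod.swap i))) has_sum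
        1 / 2 * (g (cross_u X) (cross_v X) + g (cross_u X) (cross_v X))) weights"
      by (intro has_sum_cmult_right has_sum_add 1 2)
    have "1 / 2 * (?a i + ?a (prod.swap i)) = symmetrized_term b i X" if "i \<in> weights" for i
    proof -
      obtain h hb where i: "i = (h, hb)" by (cases i)
      have "b hb h = b h hb" unfolding b_def using bcoeff_sym p_sym by blast
      thus ?thesis
        using symmetrized_term_eq[OF X, of h hb b] that by (simp add: i r_def algebra_simps)
    qed
    from infsumI[OF iffD1[OF has_sum_cong[OF this] 3]]
    have "S X = g (cross_u X) (cross_v X)"
      by (simp add: S_def)
    thus "G (complexify Y) = GE Y"
      using form[OF inj_config[OF Y]] xsq_ordered_domain_nonzero[OF X]
      by (simp add: G_def powr_def flip: X_def)
  qed
qed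

end
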